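(* Let $M$ be a smooth surface in the Heisenberg group $\mathbb{H}^1$ which is connected, orientable, compact, and without boundary. Assume that there are no characteristic points of $M$ outside of the line $\{(0,0,t)\in\mathbb{H}^1 : t\in\mathbb{R}\}$. Suppose that there is a constant $c\neq 0$ such that at every non-characteristic point $\xi=(x,y,t)\in M$ the horizontal mean curvature of $M$ (with respect to the outward normal) satisfies $H_M(\xi)=c\sqrt{x^2+y^2}$. Then $c>0$ and there exists $t_0\in\mathbb{R}$ such that $M=\partial B_R(\xi_0)$ with $R=\sqrt{\frac{3}{c}}$ and $\xi_0=(0,0,t_0)$.
   Context: The Heisenberg group $\mathbb{H}^1$ is $\mathbb{R}^3$ with points $\xi=(x,y,t)$ and group law $(x,y,t)\circ(x',y',t')=(x+x',y+y',t+t'+2(xy'-yx'))$. Let $X=\partial_x-2y\,\partial_t$, $Y=\partial_y+2x\,\partial_t$, $T=\partial_t$, let $\mathcal{H}_\xi=\mathrm{span}\{X,Y\}$ at $\xi$ be the horizontal distribution, let $\langle\cdot,\cdot\rangle$ be the Riemannian metric making $\{X,Y,T\}$ orthonormal, with norm $|\cdot|$ and Levi-Civita connection $\nabla$, and let $\mathcal{P}_H$ be the orthogonal projection onto $\mathcal{H}$. The homogeneous gauge is $\rho(x,y,t)=((x^2+y^2)^2+t^2)^{1/4}$ and the gauge balls are $B_R(\xi_0)=\{\xi : \rho(\xi_0^{-1}\circ\xi)<R\}$. A smooth surface $M\subset\mathbb{H}^1$ is an (embedded) codimension-one submanifold of class $C^2$ that is $C^\infty$ away from its characteristic set. Let $\nu$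 be the outward unit normal of $M$ with respect to $\langle\cdot,\cdot\rangle$ ($M$ compact without boundary). A point $\xi\in M$ is characteristic if $T_\xi M=\mathcal{H}_\xi$, equivalently $\mathcal{P}_H(\nu)=0$ at $\xi$. At non-characteristic points the horizontal normal is $\nu^H=\mathcal{P}_H(\nu)/|\mathcal{P}_H(\nu)|$. Let $J$ be the linear map on $\mathcal{H}$ with $J(X)=Y$, $J(Y)=-X$, and $\eta=-J\nu^H$, which spans $\mathcal{H}\cap TM$. The horizontal mean curvature of $M$ at a non-characteristic point $\xi$ is $H_M(\xi)=\langle\nabla_\eta\nu^H,\eta\rangle$ (equivalently, the divergence of $\nu^H$). *)

theory Defs
  imports "HOL-Analysis.Analysis" "HOL-Library.Extended_Nat"
begin

section \<open>Calculus in coordinates\<close>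

definition partial :: "'n::finite \<Rightarrow> (real^'n \<Rightarrow> real) \<Rightarrow> real^'n \<Rightarrow> real" where
  "partial i f p = frechet_derivative f (at p) (axis i 1)"

text \<open>Only meant for open \<open>U\<close>.\<close>

primrec C_n_on :: "nat \<Rightarrow> (real^'n::finite \<Rightarrow> real) \<Rightarrow> (real^'n) set \<Rightarrow> bool" where
  "C_n_on 0 f U \<longleftrightarrow> continuous_on U f"
| "C_n_on (Suc n) f U \<longleftrightarrow> f differentiable_on U \<and> (\<forall>i. C_n_on n (partial i f) U)"

definition C_on :: "enat \<Rightarrow> (real^'n::finite \<Rightarrow> real) \<Rightarrow> (real^'n) set \<Rightarrow> bool" where
  "C_on k f U \<longleftrightarrow> (\<forall>n. enat n \<le> k \<longrightarrow> C_n_on n f U)"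

text \<open>Near \<open>p\<close>, \<open>M\<close> is an embedded hypersurface of class \<open>C\<^sup>k\<close> without boundary:
  the zero set of a \<open>C\<^sup>k\<close> function with nowhere vanishing differential.\<close>

definition hypersurface_at :: "enat \<Rightarrow> (real^'n::finite) set \<Rightarrow> real^'n \<Rightarrow> bool" where
  "hypersurface_at k M p \<longleftrightarrow>
     (\<exists>U f. open U \<and> p \<in> U \<and> C_on k f U \<and> (\<forall>q\<in>U. \<exists>i. partial i f q \<noteq> 0) \<and>
            M \<inter> U = {q \<in> U. f q = 0})"

definition tangent_space :: "(real^'n::finite) set \<Rightarrow> real^'n \<Rightarrow> (real^'n) set" where
  "tangent_space M p =
     {v. \<exists>\<gamma>. \<gamma> 0 = p \<and> (\<forall>\<^sub>F s in nhds (0::real). \<gamma> s \<in> M) \<and>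
             (\<gamma> has_vector_derivative v) (at 0)}"

section \<open>The Levi-Civita connection of a metric given by its Gram matrix\<close>

definition christoffel ::
    "(real^'n \<Rightarrow> real^'n^'n) \<Rightarrow> real^'n \<Rightarrow> 'n::finite \<Rightarrow> 'n \<Rightarrow> 'n \<Rightarrow> real" where
  "christoffel G p k i j =
     (\<Sum>l\<in>UNIV. matrix_inv (G p) $ k $ l *
        (partial i (\<lambda>q. G q $ j $ l) p + partial j (\<lambda>q. G q $ i $ l) p
         - partial l (\<lambda>q. G q $ i $ j) p)) / 2"

text \<open>\<open>\<nabla>\<^sub>v W\<close> at \<open>p \<in> M\<close> for a vector field \<open>W\<close> along \<open>M\<close>. Only meaningful for \<open>v\<close> tangent
  to \<open>M\<close>: derivatives within the hypersurface \<open>M\<close> are not unique, but they all agree on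
  tangent vectors.\<close>

definition covariant_deriv ::
    "(real^'n \<Rightarrow> real^'n^'n) \<Rightarrow> (real^'n::finite) set \<Rightarrow> (real^'n \<Rightarrow> real^'n) \<Rightarrow>
     real^'n \<Rightarrow> real^'n \<Rightarrow> real^'n" where
  "covariant_deriv G M W p v =
     frechet_derivative W (at p within M) v
     + (\<chi> k. \<Sum>i\<in>UNIV. \<Sum>j\<in>UNIV. christoffel G p k i j * v $ i * W p $ j)"

section \<open>The Heisenberg group\<close>

definition heis_mult :: "real^3 \<Rightarrow> real^3 \<Rightarrow> real^3" where
  "heis_mult p q =
     vector [p$1 + q$1, p$2 + q$2, p$3 + q$3 + 2 * (p$1 * q$2 - p$2 * q$1)]"

definition heis_inv :: "real^3 \<Rightarrow> real^3" where
  "heis_inv p = - p"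

lemma heis_inv: "heis_mult (heis_inv p) p = 0" "heis_mult p (heis_inv p) = 0"
  by (simp_all add: heis_mult_def heis_inv_def vec_eq_iff forall_3 vector_3)

definition homogeneous_gauge :: "real^3 \<Rightarrow> real" where
  "homogeneous_gauge p = root 4 (((p$1)\<^sup>2 + (p$2)\<^sup>2)\<^sup>2 + (p$3)\<^sup>2)"

definition gauge_ball :: "real^3 \<Rightarrow> real \<Rightarrow> (real^3) set" where
  "gauge_ball p0 R = {p. homogeneous_gauge (heis_mult (heis_inv p0) p) < R}"

definition X_field :: "real^3 \<Rightarrow> real^3" where
  "X_field p = vector [1, 0, - 2 * p$2]"

definition Y_field :: "real^3 \<Rightarrow> real^3" where
  "Y_field p = vector [0, 1, 2 * p$1]"

definition T_field :: "real^3 \<Rightarrow> real^3" where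
  "T_field p = vector [0, 0, 1]"

definition horizontal_space :: "real^3 \<Rightarrow> (real^3) set" where
  "horizontal_space p = span {X_field p, Y_field p}"

text \<open>\<open>dx\<^sup>2 + dy\<^sup>2 + (dt + 2y dx - 2x dy)\<^sup>2\<close>, written in the coframe dual to \<open>X, Y, T\<close>.\<close>

definition heis_inner :: "real^3 \<Rightarrow> real^3 \<Rightarrow> real^3 \<Rightarrow> real" where
  "heis_inner p v w =
     v$1 * w$1 + v$2 * w$2
     + (v$3 + 2 * p$2 * v$1 - 2 * p$1 * v$2) * (w$3 + 2 * p$2 * w$1 - 2 * p$1 * w$2)"

lemma heis_inner_orthonormal_frame:
  "heis_inner p (X_field p) (X_field p) = 1"
  "heis_inner p (Y_field p) (Y_field p) = 1"
  "heis_inner p (T_field p) (T_field p) = 1"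
  "heis_inner p (X_field p) (Y_field p) = 0"
  "heis_inner p (X_field p) (T_field p) = 0"
  "heis_inner p (Y_field p) (T_field p) = 0"
  by (simp_all add: heis_inner_def X_field_def Y_field_def T_field_def vector_3)

definition heis_norm :: "real^3 \<Rightarrow> real^3 \<Rightarrow> real" where
  "heis_norm p v = sqrt (heis_inner p v v)"

definition heis_gram :: "real^3 \<Rightarrow> real^3^3" where
  "heis_gram p = (\<chi> i j. heis_inner p (axis i 1) (axis j 1))"

definition horizontal_proj :: "real^3 \<Rightarrow> real^3 \<Rightarrow> real^3" where
  "horizontal_proj p v =
     heis_inner p v (X_field p) *\<^sub>R X_field p + heis_inner p v (Y_field p) *\<^sub>R Y_field p"

text \<open>The map with \<open>J X = Y\<close> and \<open>J Y = - X\<close>; only meant for horizontal \<open>v\<close>.\<close>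

definition J_map :: "real^3 \<Rightarrow> real^3 \<Rightarrow> real^3" where
  "J_map p v =
     heis_inner p v (X_field p) *\<^sub>R Y_field p - heis_inner p v (Y_field p) *\<^sub>R X_field p"

section \<open>Surfaces in the Heisenberg group\<close>

definition characteristic :: "(real^3) set \<Rightarrow> real^3 \<Rightarrow> bool" where
  "characteristic M p \<longleftrightarrow> p \<in> M \<and> tangent_space M p = horizontal_space p"

definition smooth_surface :: "(real^3) set \<Rightarrow> bool" where
  "smooth_surface M \<longleftrightarrow>
     (\<forall>p\<in>M. hypersurface_at 2 M p) \<and>
     (\<forall>p\<in>M. \<not> characteristic M p \<longrightarrow> hypersurface_at \<infinity> M p)"

definition unit_normal :: "(real^3) set \<Rightarrow> real^3 \<Rightarrow> real^3 \<Rightarrow> bool" where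
  "unit_normal M p n \<longleftrightarrow>
     heis_norm p n = 1 \<and> (\<forall>v\<in>tangent_space M p. heis_inner p n v = 0)"

definition orientable_surface :: "(real^3) set \<Rightarrow> bool" where
  "orientable_surface M \<longleftrightarrow>
     (\<exists>N. continuous_on M N \<and> (\<forall>p\<in>M. unit_normal M p (N p)))"

text \<open>For a compact connected surface \<open>M\<close>, by the Jordan--Brouwer theorem, exactly one of the
  two unit normals at each point of \<open>M\<close> points from the bounded component \<open>inside M\<close> of the
  complement to the unbounded component \<open>outside M\<close>.\<close>

definition outward_unit_normal :: "(real^3) set \<Rightarrow> (real^3 \<Rightarrow> real^3) \<Rightarrow> bool" where
  "outward_unit_normal M \<nu> \<longleftrightarrow>
     (\<forall>p\<in>M. unit_normal M p (\<nu> p) \<and>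
        (\<forall>\<^sub>F s in at_right (0::real). p + s *\<^sub>R \<nu> p \<in> outside M \<and> p - s *\<^sub>R \<nu> p \<in> inside M))"

definition horizontal_normal :: "(real^3 \<Rightarrow> real^3) \<Rightarrow> real^3 \<Rightarrow> real^3" where
  "horizontal_normal \<nu> p =
     (1 / heis_norm p (horizontal_proj p (\<nu> p))) *\<^sub>R horizontal_proj p (\<nu> p)"

definition eta :: "(real^3 \<Rightarrow> real^3) \<Rightarrow> real^3 \<Rightarrow> real^3" where
  "eta \<nu> p = - J_map p (horizontal_normal \<nu> p)"

text \<open>\<open>\<nu>\<close> is a unit normal field of \<open>M\<close>, and \<open>p\<close> a non-characteristic point of \<open>M\<close>.\<close>

definition horizontal_mean_curvature ::
    "(real^3) set \<Rightarrow> (real^3 \<Rightarrow> real^3) \<Rightarrow> real^3 \<Rightarrow> real" where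
  "horizontal_mean_curvature M \<nu> p =
     heis_inner p
       (covariant_deriv heis_gram M (horizontal_normal \<nu>) p (eta \<nu> p)) (eta \<nu> p)"

end

theory Submission
  imports Defs
begin

text \<open>
  Write \<open>r = \<bar>(x, y)\<bar>\<close>, let \<open>(a, b)\<close> be the components of the horizontal normal, and put \<open>m = x a + y b\<close> and
  \<open>h = y a - x b\<close>. Along a leaf, an integral curve of \<open>- \<eta>\<close>, the curvature equation gives \<open>m' = c r h\<close>,
  \<open>h' = 1 - c r m\<close>, \<open>r r' = h\<close> and \<open>t' = 2 m\<close>. Hence \<open>A = m - c r\<^sup>3 / 3\<close> is constant along leaves, while
  \<open>c t / 2 + h / r\<close> increases, its derivative being \<open>m\<^sup>2 / r\<^sup>3\<close>. On a compact surface this forces \<open>A = 0\<close>.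
  No flow is needed: at a maximum point on \<open>M\<close> of \<open>A\<^sup>2\<close> times the exponential of a strictly increasing
  function, differentiating along a single curve in \<open>M\<close> that is tangent to the leaf shows \<open>A = 0\<close>.

  At a point of maximal \<open>r\<close> the outward normal is radial, so \<open>m = r\<close>, \<open>c = 3 / r\<^sup>2 > 0\<close> and \<open>r = R\<close>. Now \<open>m = r\<^sup>3 / R\<^sup>2\<close>, so
  \<open>\<tau> = t + R\<^sup>2 h / r\<close> is constant along leaves and \<open>r\<^sup>4 + (t - \<tau>)\<^sup>2 = R\<^sup>4\<close>. The function \<open>t + R h / 2\<close> is strictly increasing
  along leaves, across the axis as well, so the same maximum argument, applied to a function of \<open>\<tau>\<close> of period
  \<open>2 R\<^sup>2\<close> that vanishes at the spheres having a characteristic point as a pole, shows that \<open>\<tau>\<close> takes finitely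
  many values. Therefore every point of \<open>M\<close> on the axis is characteristic, \<open>\<tau>\<close> is locally constant, and \<open>M\<close>
  lies in one gauge sphere. It is the whole sphere since otherwise its complement would be connected,
  leaving no inside for the normal to point out of.
\<close>

section \<open>Level sets\<close>

text \<open>The map \<open>\<Phi>\<close> replaces the coordinate of a point along the unit normal
  \<open>e\<close> by the value of \<open>f\<close>, so its local inverse \<open>g\<close> turns
  hyperplanes orthogonal to \<open>e\<close> into level sets. Its derivative at \<open>p\<close>
  fixes the vectors orthogonal to \<open>e\<close>, hence so does that of \<open>g\<close>.\<close>

lemma level_set_chart:
  fixes f :: "'a::euclidean_space \<Rightarrow> real" and G :: "'a \<Rightarrow> 'a"
  assumes "open U" "p \<in> U" and der: "\<And>x. x \<in> U \<Longrightarrow> (f has_derivative (\<lambda>h. G x \<bullet> h)) (at x)"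
    and cG: "continuous_on U G" and fp: "f p = 0" and Gp: "G p \<noteq> 0"
  obtains N g \<delta> e where "open N" "p \<in> N" "N \<subseteq> U" "\<delta> > 0" "norm e = 1" "G p = norm (G p) *\<^sub>R e" "g p = p"
    "continuous_on (ball p \<delta>) g" "g ` ball p \<delta> = N" "inj_on g (ball p \<delta>)"
    "\<And>y. y \<in> ball p \<delta> \<Longrightarrow> f (g y) = e \<bullet> (y - p)"
    "\<And>v. e \<bullet> v = 0 \<Longrightarrow> ((\<lambda>s. g (p + s *\<^sub>R v)) has_vector_derivative v) (at 0)"
proof -
  define e where "e = sgn (G p)"
  define k where "k = norm (G p)"
  have k: "k > 0" using Gp by (simp add: k_def)
  have e1: "norm e = 1" using Gp by (simp add: e_def norm_sgn)
  have ee: "e \<bullet> e = 1" using e1 by (simp add: dot_square_norm)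
  have Ge: "G p = k *\<^sub>R e" using k by (simp add: e_def k_def sgn_div_norm)
  define \<Phi> where "\<Phi> x = x + (f x - e \<bullet> (x - p)) *\<^sub>R e" for x
  define \<Phi>' where "\<Phi>' x = id_blinfun + (blinfun_scaleR_left e o\<^sub>L blinfun_inner_left (G x - e))" for x
  \<comment> \<open>The derivative of \<open>\<Phi>\<close> at \<open>p\<close> scales
    \<open>e\<close> by \<open>k\<close> and fixes its orthogonal complement; \<open>J\<close>
    undoes this.\<close>
  define J where "J = id_blinfun + (blinfun_scaleR_left e o\<^sub>L blinfun_inner_left ((1/k - 1) *\<^sub>R e))"
  have \<Phi>'_apply: "blinfun_apply (\<Phi>' x) h = h + ((G x - e) \<bullet> h) *\<^sub>R e" for x h
    by (simp add: \<Phi>'_def blinfun.bilinear_simps inner_commute)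
  have J_apply: "blinfun_apply J h = h + ((1/k - 1) * (e \<bullet> h)) *\<^sub>R e" for h
    by (simp add: J_def blinfun.bilinear_simps inner_commute)
  have d: "(\<Phi> has_derivative blinfun_apply (\<Phi>' x)) (at x)" if "x \<in> U" for x
    unfolding \<Phi>_def
    by (rule derivative_eq_intros der[OF that] refl)+
      (auto simp: \<Phi>'_apply[abs_def] inner_diff_left fun_eq_iff)
  have c: "continuous_on U \<Phi>'"
    unfolding \<Phi>'_def
    by (intro continuous_intros cG bounded_linear.continuous_on[OF bounded_linear_blinfun_inner_left])
  have inv: "J o\<^sub>L \<Phi>' p = id_blinfun"
  proof (rule blinfun_eqI)
    fix h
    have "(1/k - 1) * (e \<bullet> (h + ((k - 1) * (e \<bullet> h)) *\<^sub>R e)) + (k - 1) * (e \<bullet> h)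
        = (1/k - 1) * (k * (e \<bullet> h)) + (k - 1) * (e \<bullet> h)"
      by (simp add: inner_add_right ee algebra_simps)
    also have "\<dots> = 0" using k by (simp add: field_simps)
    finally show "blinfun_apply (J o\<^sub>L \<Phi>' p) h = blinfun_apply id_blinfun h"
      by (simp add: \<Phi>'_apply J_apply Ge inner_diff_left inner_scaleR_left flip: scaleR_add_left)
         (simp add: algebra_simps flip: scaleR_add_left)
  qed
  obtain U' V g g' where *: "open U'" "U' \<subseteq> U" "p \<in> U'" "open V" "\<Phi> p \<in> V" "homeomorphism U' V \<Phi> g"
    "\<And>y. y \<in> V \<Longrightarrow> (g has_derivative (g' y)) (at y)"
    "\<And>y. y \<in> V \<Longrightarrow> g' y = inv (blinfun_apply (\<Phi>'(g y)))"
    "\<And>y. y \<in> V \<Longrightarrow> bij (blinfun_apply (\<Phi>'(g y)))"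
    using inverse_function_theorem[OF \<open>open U\<close> d c \<open>p \<in> U\<close> inv] by blast
  have \<Phi>p: "\<Phi> p = p" by (simp add: \<Phi>_def fp)
  obtain \<delta> where \<delta>: "\<delta> > 0" "ball p \<delta> \<subseteq> V" using *(4,5) \<Phi>p by (metis open_contains_ball)
  note hom = \<open>homeomorphism U' V \<Phi> g\<close>
  have gp: "g p = p" using hom *(3) \<Phi>p by (metis homeomorphism_apply1)
  have cg: "continuous_on V g" using hom by (simp add: homeomorphism_def)
  have \<Phi>g: "\<Phi> (g y) = y" if "y \<in> V" for y using hom that by (simp add: homeomorphism_def)
  show thesis
  proof
    show "\<delta> > 0" "norm e = 1" "G p = norm (G p) *\<^sub>R e" "g p = p" "g ` ball p \<delta> = g ` ball p \<delta>"
      using \<delta> e1 Ge gp by (auto simp: k_def)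
    show "continuous_on (ball p \<delta>) g" using cg \<delta>(2) continuous_on_subset by blast
    show "inj_on g (ball p \<delta>)" by (metis \<Phi>g \<delta>(2) inj_on_def subset_iff)
    show "p \<in> g ` ball p \<delta>" using gp \<delta>(1) by (metis centre_in_ball imageI)
    show "g ` ball p \<delta> \<subseteq> U" using homeomorphism_image2[OF hom] *(2) \<delta>(2) by blast
    have "g ` ball p \<delta> = U' \<inter> \<Phi> -` ball p \<delta>"
    proof (intro equalityI subsetI)
      fix x assume "x \<in> g ` ball p \<delta>"
      then show "x \<in> U' \<inter> \<Phi> -` ball p \<delta>" using \<Phi>g \<delta>(2) homeomorphism_image2[OF hom] by auto
    next
      fix x assume "x \<in> U' \<inter> \<Phi> -` ball p \<delta>"
      then show "x \<in> g ` ball p \<delta>" using homeomorphism_apply1[OF hom, of x] by force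
    qed
    then show "open (g ` ball p \<delta>)"
      using continuous_open_preimage[OF homeomorphism_cont1[OF hom] *(1) open_ball] by simp
    show "f (g y) = e \<bullet> (y - p)" if "y \<in> ball p \<delta>" for y
    proof -
      have "e \<bullet> (\<Phi> (g y) - p) = f (g y)"
        by (simp add: \<Phi>_def inner_add_right inner_diff_right ee)
      then show ?thesis using \<Phi>g that \<delta>(2) by auto
    qed
    show "((\<lambda>s. g (p + s *\<^sub>R v)) has_vector_derivative v) (at 0)" if ev: "e \<bullet> v = 0" for v
    proof -
      have pV: "p \<in> V" using \<delta> centre_in_ball by blast
      have "blinfun_apply (\<Phi>' p) v = v" by (simp add: \<Phi>'_apply Ge inner_diff_left ev)
      then have "g' p v = v" using *(8,9)[OF pV] by (metis gp bij_inv_eq_iff)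
      moreover have "(g has_derivative g' p) (at ((\<lambda>s. p + s *\<^sub>R v) 0))" using *(7)[OF pV] by simp
      moreover have "((\<lambda>s. p + s *\<^sub>R v) has_derivative (\<lambda>s. s *\<^sub>R v)) (at (0::real))"
        by (auto intro!: derivative_eq_intros)
      ultimately have "((\<lambda>s. g (p + s *\<^sub>R v)) has_derivative (\<lambda>s. g' p (s *\<^sub>R v))) (at 0)"
        using has_derivative_compose[of "\<lambda>s. p + s *\<^sub>R v" "\<lambda>s. s *\<^sub>R v" 0 UNIV g "g' p"] by simp
      moreover have "g' p (s *\<^sub>R v) = s *\<^sub>R v" for s
        using \<open>g' p v = v\<close> *(7)[OF pV] by (simp add: has_derivative_bounded_linear linear_simps(5))
      ultimately show ?thesis by (simp add: has_vector_derivative_def)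
    qed
  qed
qed


text \<open>Differentiating \<open>f = 0\<close> along a curve in \<open>M\<close> gives one
  inclusion; for the other, the chart bends the line through \<open>p\<close> in direction
  \<open>v\<close> into \<open>M\<close>.\<close>

lemma level_set_tangent_space:
  fixes f :: "real^'n::finite \<Rightarrow> real" and G :: "real^'n \<Rightarrow> real^'n"
  assumes "open U" "p \<in> U" and der: "\<And>x. x \<in> U \<Longrightarrow> (f has_derivative (\<lambda>h. G x \<bullet> h)) (at x)"
    and cG: "continuous_on U G" and fp: "f p = 0" and Gp: "G p \<noteq> 0"
    and M: "M \<inter> U = {x \<in> U. f x = 0}"
  shows "tangent_space M p = {v. G p \<bullet> v = 0}"
proof (intro equalityI subsetI)
  fix v assume "v \<in> tangent_space M p"
  then obtain \<gamma> where \<gamma>: "\<gamma> 0 = p" "\<forall>\<^sub>F s in nhds (0::real). \<gamma> s \<in> M" "(\<gamma> has_vector_derivative v) (at 0)"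
    by (auto simp: tangent_space_def)
  have "((\<lambda>s. f (\<gamma> s)) has_derivative (\<lambda>s. G p \<bullet> (s *\<^sub>R v))) (at 0)"
    using has_derivative_compose[of \<gamma> "\<lambda>s. s *\<^sub>R v" 0 UNIV f "\<lambda>h. G p \<bullet> h"] \<gamma> der[OF \<open>p \<in> U\<close>]
    by (simp add: has_vector_derivative_def)
  moreover have "((\<lambda>s. f (\<gamma> s)) has_derivative (\<lambda>s. 0)) (at 0)"
  proof -
    have "(\<gamma> \<longlongrightarrow> \<gamma> 0) (at 0)"
      using \<gamma>(3) has_vector_derivative_continuous isCont_def by blast
    then have "\<forall>\<^sub>F s in at 0. \<gamma> s \<in> U" using \<open>open U\<close> \<open>p \<in> U\<close> \<gamma>(1) by (metis topological_tendstoD)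
    moreover have "\<forall>\<^sub>F s in at 0. \<gamma> s \<in> M" using \<gamma>(2) by (simp add: eventually_nhds_conv_at)
    ultimately have "\<forall>\<^sub>F s in at 0. f (\<gamma> s) = 0" by eventually_elim (use M in blast)
    then have ev: "\<forall>\<^sub>F s in at 0. 0 = f (\<gamma> s)" by eventually_elim simp
    show ?thesis
      by (rule has_derivative_transform_eventually[OF _ ev]) (use \<gamma>(1) fp in auto)
  qed
  ultimately have "(\<lambda>s. G p \<bullet> (s *\<^sub>R v)) = (\<lambda>s. 0)" using has_derivative_unique by blast
  then show "v \<in> {v. G p \<bullet> v = 0}" by (metis (mono_tags) mem_Collect_eq scaleR_one)
next
  fix v assume v: "v \<in> {v. G p \<bullet> v = 0}"
  obtain N g \<delta> e where *: "open N" "p \<in> N" "N \<subseteq> U" "\<delta> > 0" "norm e = 1" "G p = norm (G p) *\<^sub>R e" "g p = p"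
    "continuous_on (ball p \<delta>) g" "g ` ball p \<delta> = N" "inj_on g (ball p \<delta>)"
    "\<And>y. y \<in> ball p \<delta> \<Longrightarrow> f (g y) = e \<bullet> (y - p)"
    "\<And>v. e \<bullet> v = 0 \<Longrightarrow> ((\<lambda>s. g (p + s *\<^sub>R v)) has_vector_derivative v) (at 0)"
    by (rule level_set_chart[OF assms(1,2) der cG fp Gp]) (assumption | rule that)+
  have "G p \<bullet> v = norm (G p) * (e \<bullet> v)" using arg_cong[OF *(6), of "\<lambda>w. w \<bullet> v"] by simp
  then have "norm (G p) * (e \<bullet> v) = 0" using v by simp
  then have ev: "e \<bullet> v = 0" using Gp by simp
  have "((\<lambda>s. p + s *\<^sub>R v) \<longlongrightarrow> p + 0 *\<^sub>R v) (nhds (0::real))"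
    by (intro tendsto_intros filterlim_ident)
  then have "\<forall>\<^sub>F s in nhds (0::real). p + s *\<^sub>R v \<in> ball p \<delta>"
    by (rule topological_tendstoD) (use *(4) in auto)
  then have "\<forall>\<^sub>F s in nhds (0::real). g (p + s *\<^sub>R v) \<in> M"
  proof eventually_elim
    case (elim s)
    then have "g (p + s *\<^sub>R v) \<in> U" "f (g (p + s *\<^sub>R v)) = 0" using *(3,9,11) ev by auto
    then show ?case using M by blast
  qed
  then show "v \<in> tangent_space M p"
    unfolding tangent_space_def using *(7,12) ev by (auto intro!: exI[of _ "\<lambda>s. g (p + s *\<^sub>R v)"])
qed

text \<open>The chart carries half balls to the two sides of the level set and a flat disc to the
  level set itself. The connected sides serve to orient the normal, the connected punctured disc to
  transport the leaf center past a characteristic point.\<close>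

lemma level_set_local_topology:
  fixes f :: "'a::euclidean_space \<Rightarrow> real" and G :: "'a \<Rightarrow> 'a"
  assumes "open U" "p \<in> U" and der: "\<And>x. x \<in> U \<Longrightarrow> (f has_derivative (\<lambda>h. G x \<bullet> h)) (at x)"
    and cG: "continuous_on U G" and fp: "f p = 0" and Gp: "G p \<noteq> 0" and dim: "DIM('a) \<ge> 3"
  obtains N where "open N" "p \<in> N" "N \<subseteq> U" "connected {x \<in> N. f x > 0}" "connected {x \<in> N. f x < 0}"
    "connected ({x \<in> N. f x = 0} - {p})" "p islimpt {x \<in> N. f x = 0}"
proof -
  obtain N g \<delta> e where *: "open N" "p \<in> N" "N \<subseteq> U" "\<delta> > 0" "norm e = 1" "G p = norm (G p) *\<^sub>R e" "g p = p"
    "continuous_on (ball p \<delta>) g" "g ` ball p \<delta> = N" "inj_on g (ball p \<delta>)"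
    "\<And>y. y \<in> ball p \<delta> \<Longrightarrow> f (g y) = e \<bullet> (y - p)"
    "\<And>v. e \<bullet> v = 0 \<Longrightarrow> ((\<lambda>s. g (p + s *\<^sub>R v)) has_vector_derivative v) (at 0)"
    by (rule level_set_chart[OF assms(1,2) der cG fp Gp]) (assumption | rule that)+
  have half: "connected {x \<in> N. Q (f x)}" if "convex {y. Q (e \<bullet> (y - p))}" for Q
  proof -
    have "{x \<in> N. Q (f x)} = g ` (ball p \<delta> \<inter> {y. Q (e \<bullet> (y - p))})"
      using *(9,11) by (auto simp: image_iff)
    moreover have "connected (ball p \<delta> \<inter> {y. Q (e \<bullet> (y - p))})"
      using that by (intro convex_connected convex_Int convex_ball)
    ultimately show ?thesis
      by (metis (no_types) connected_continuous_image[OF continuous_on_subset[OF *(8)]] inf_le1)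
  qed
  let ?H = "{y. e \<bullet> y = e \<bullet> p}"
  have H: "convex ?H" "p \<in> ?H" "convex (?H \<inter> ball p \<delta>)" by (simp_all add: convex_hyperplane convex_Int)
  have e0: "e \<noteq> 0" using *(5) by auto
  have "aff_dim (?H \<inter> ball p \<delta>) = aff_dim ?H"
    using H *(4) by (intro aff_dim_convex_Int_open) (auto intro: centre_in_ball)
  also have "\<dots> = DIM('a) - 1" using e0 by (simp add: aff_dim_hyperplane)
  \<comment> \<open>Dimension at least two keeps the disc connected after removal of
    \<open>p\<close> and rules out that it is a single point.\<close>
  finally have ad: "aff_dim (?H \<inter> ball p \<delta>) \<ge> 2" using dim by linarith
  have img: "{x \<in> N. f x = 0} = g ` (?H \<inter> ball p \<delta>)"
    using *(9,11) by (auto simp: image_iff inner_diff_right)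
  have pin: "p \<in> ?H \<inter> ball p \<delta>" using *(4) by simp
  have img2: "{x \<in> N. f x = 0} - {p} = g ` (?H \<inter> ball p \<delta> - {p})"
    using *(7,10) pin unfolding img by (auto simp: inj_on_def)
  have con: "connected (?H \<inter> ball p \<delta> - {p})"
    using H(3) ad by (intro connected_punctured_convex) auto
  show thesis
  proof
    show "open N" "p \<in> N" "N \<subseteq> U" using * by auto
    have "convex {y. 0 < e \<bullet> (y - p)}" "convex {y. e \<bullet> (y - p) < 0}"
      using convex_halfspace_gt[of "e \<bullet> p" e] convex_halfspace_lt[of e "e \<bullet> p"]
      by (simp_all add: inner_diff_right)
    then show "connected {x \<in> N. f x > 0}" "connected {x \<in> N. f x < 0}"
      using half[of "\<lambda>u. u > 0"] half[of "\<lambda>u. u < 0"] by auto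
    show "connected ({x \<in> N. f x = 0} - {p})"
      unfolding img2 by (rule connected_continuous_image[OF continuous_on_subset[OF *(8)] con]) auto
    have "connected {x \<in> N. f x = 0}" 
      unfolding img by (rule connected_continuous_image[OF continuous_on_subset[OF *(8)] convex_connected[OF H(3)]]) auto
    moreover have "p \<in> {x \<in> N. f x = 0}" using *(2) fp by simp
    moreover have "{x \<in> N. f x = 0} \<noteq> {x}" for x
    proof
      assume eq: "{x \<in> N. f x = 0} = {x}"
      have "p \<in> {x \<in> N. f x = 0}" using *(2) fp by simp
      then have "x = p" unfolding eq by simp
      then have "?H \<inter> ball p \<delta> \<subseteq> {p}" using img2 eq by blast
      then have "aff_dim (?H \<inter> ball p \<delta>) \<le> aff_dim {p}" by (rule aff_dim_subset)
      then show False using ad by simp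
    qed
    ultimately show "p islimpt {x \<in> N. f x = 0}" by (intro connected_imp_perfect) blast+
  qed
qed

section \<open>The outward normal\<close>

lemma hypersurface_at_2_level_set:
  fixes M :: "(real^'n::finite) set"
  assumes "hypersurface_at 2 M p"
  obtains U f G where "open U" "p \<in> U" "\<And>x. x \<in> U \<Longrightarrow> (f has_derivative (\<lambda>h. G x \<bullet> h)) (at x)"
    "\<And>x. x \<in> U \<Longrightarrow> G differentiable (at x)" "\<And>x. x \<in> U \<Longrightarrow> G x \<noteq> 0" "M \<inter> U = {x \<in> U. f x = 0}"
proof -
  obtain U f where U: "open U" "p \<in> U" "C_on 2 f U" "\<forall>q\<in>U. \<exists>i. partial i f q \<noteq> 0" "M \<inter> U = {q \<in> U. f q = 0}"
    using assms by (auto simp: hypersurface_at_def)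
  have "C_n_on 2 f U" using U(3) unfolding C_on_def by (metis numeral_eq_enat order_refl)
  then have "C_n_on (Suc (Suc 0)) f U" by (simp add: numeral_2_eq_2)
  then have d: "f differentiable_on U" and dp: "partial i f differentiable_on U" for i
    by (simp_all only: C_n_on.simps) 
  define G where "G x = (\<chi> i. partial i f x)" for x
  show thesis
  proof
    fix x assume x: "x \<in> U"
    then have "f differentiable (at x)" using d U(1) by (simp add: differentiable_on_eq_differentiable_at)
    then have *: "(f has_derivative frechet_derivative f (at x)) (at x)" using frechet_derivative_works by blast
    then have l: "linear (frechet_derivative f (at x))" by (rule has_derivative_linear)
    have "frechet_derivative f (at x) h = G x \<bullet> h" for h
    proof -
      have "frechet_derivative f (at x) h = frechet_derivative f (at x) (\<Sum>i\<in>UNIV. h $ i *\<^sub>R axis i 1)"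
        using basis_expansion[of h] by (simp add: scalar_mult_eq_scaleR)
      also have "\<dots> = (\<Sum>i\<in>UNIV. h $ i * frechet_derivative f (at x) (axis i 1))"
        by (simp add: linear_sum[OF l] linear_cmul[OF l])
      finally show ?thesis by (simp add: inner_vec_def G_def partial_def mult.commute)
    qed
    then have "frechet_derivative f (at x) = (\<lambda>h. G x \<bullet> h)" by (rule ext)
    then show "(f has_derivative (\<lambda>h. G x \<bullet> h)) (at x)" using * by simp
    have "partial i f differentiable (at x)" for i
      using dp U(1) x by (simp add: differentiable_on_eq_differentiable_at)
    then have "\<And>i. (\<lambda>x. G x \<bullet> axis i 1) differentiable (at x)"
      by (simp add: G_def inner_axis)
    then show "G differentiable (at x)"
      by (subst differentiable_componentwise_within) (auto simp: Basis_vec_def)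
    show "G x \<noteq> 0" using U(4) x by (auto simp: G_def vec_eq_iff)
  qed (use U in auto)
qed

section \<open>Unit normals in the Heisenberg frame\<close>

lemma heis_frame_expansion:
  "v = v$1 *\<^sub>R X_field p + v$2 *\<^sub>R Y_field p + (v$3 + 2 * p$2 * v$1 - 2 * p$1 * v$2) *\<^sub>R T_field p"
  by (simp add: vec_eq_iff forall_3 X_field_def Y_field_def T_field_def vector_3 algebra_simps)

lemma inner_heis_frame:
  "g \<bullet> X_field p = g$1 - 2 * p$2 * g$3" "g \<bullet> Y_field p = g$2 + 2 * p$1 * g$3" "g \<bullet> T_field p = g$3"
  by (simp_all add: inner_vec_def sum_3 X_field_def Y_field_def T_field_def vector_3)

lemma heis_frame_components:
  "X_field p $ 1 = 1" "X_field p $ 2 = 0" "X_field p $ 3 = - 2 * p$2"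
  "Y_field p $ 1 = 0" "Y_field p $ 2 = 1" "Y_field p $ 3 = 2 * p$1"
  "T_field p $ 1 = 0" "T_field p $ 2 = 0" "T_field p $ 3 = 1"
  by (simp_all add: X_field_def Y_field_def T_field_def vector_3)

text \<open>The unit normal at \<open>p\<close> for the Heisenberg metric of a surface with Euclidean normal \<open>g\<close>.\<close>

definition heis_normal :: "real^3 \<Rightarrow> real^3 \<Rightarrow> real^3" where
  "heis_normal g p = (1 / sqrt ((g \<bullet> X_field p)\<^sup>2 + (g \<bullet> Y_field p)\<^sup>2 + (g \<bullet> T_field p)\<^sup>2)) *\<^sub>R
     ((g \<bullet> X_field p) *\<^sub>R X_field p + (g \<bullet> Y_field p) *\<^sub>R Y_field p + (g \<bullet> T_field p) *\<^sub>R T_field p)"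

lemma heis_normal_minus: "heis_normal (- g) p = - heis_normal g p"
  by (simp add: heis_normal_def scaleR_add_right scaleR_diff_right)

lemma heis_covector_pos:
  fixes g :: "real^3"
  assumes "g \<noteq> 0"
  shows "(g \<bullet> X_field p)\<^sup>2 + (g \<bullet> Y_field p)\<^sup>2 + (g \<bullet> T_field p)\<^sup>2 > 0"
proof (rule ccontr)
  assume "\<not> ?thesis"
  then have "(g \<bullet> X_field p)\<^sup>2 = 0" "(g \<bullet> Y_field p)\<^sup>2 = 0" "(g \<bullet> T_field p)\<^sup>2 = 0"
    by (smt (verit) zero_le_power2)+
  then have "g = 0" by (auto simp: inner_heis_frame vec_eq_iff forall_3)
  then show False using assms by simp
qed

lemma inner_heis_normal_pos:
  assumes "g \<noteq> 0"
  shows "g \<bullet> heis_normal g p > 0"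
proof -
  let ?D = "(g \<bullet> X_field p)\<^sup>2 + (g \<bullet> Y_field p)\<^sup>2 + (g \<bullet> T_field p)\<^sup>2"
  have "?D > 0" using heis_covector_pos[OF assms] .
  moreover have "g \<bullet> heis_normal g p = (1 / sqrt ?D) * ?D"
    by (simp add: heis_normal_def inner_add_right power2_eq_square)
  ultimately show ?thesis by simp
qed

text \<open>Orthogonality to the tangent plane makes the frame coefficients of \<open>n\<close>
  proportional to those of \<open>g\<close>, and unit length leaves only the sign free.\<close>

lemma unit_normal_cases:
  assumes "unit_normal M p n" and T: "tangent_space M p = {v. g \<bullet> v = 0}" and "g \<noteq> 0"
  shows "n = heis_normal g p \<or> n = - heis_normal g p"
proof -
  define u v w where "u = g \<bullet> X_field p" and "v = g \<bullet> Y_field p" and "w = g \<bullet> T_field p"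
  define \<alpha> \<beta> \<gamma> where "\<alpha> = n$1" and "\<beta> = n$2" and "\<gamma> = n$3 + 2 * p$2 * n$1 - 2 * p$1 * n$2"
  have n: "n = \<alpha> *\<^sub>R X_field p + \<beta> *\<^sub>R Y_field p + \<gamma> *\<^sub>R T_field p"
    unfolding \<alpha>_def \<beta>_def \<gamma>_def by (rule heis_frame_expansion)
  have "heis_inner p n n = 1" using assms(1) by (simp add: unit_normal_def heis_norm_def)
  then have one: "\<alpha>\<^sup>2 + \<beta>\<^sup>2 + \<gamma>\<^sup>2 = 1" by (simp add: heis_inner_def \<alpha>_def \<beta>_def \<gamma>_def power2_eq_square)
  have perp: "heis_inner p n t = 0" if "g \<bullet> t = 0" for t
    using assms(1) T that by (simp add: unit_normal_def)
  have hin: "heis_inner p n (a *\<^sub>R X_field p + b *\<^sub>R Y_field p + c *\<^sub>R T_field p) = \<alpha> * a + \<beta> * b + \<gamma> * c" for a b c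
    by (simp add: heis_inner_def \<alpha>_def \<beta>_def \<gamma>_def heis_frame_components) 
  have gin: "g \<bullet> (a *\<^sub>R X_field p + b *\<^sub>R Y_field p + c *\<^sub>R T_field p) = u * a + v * b + w * c" for a b c
    by (simp add: u_def v_def w_def inner_add_right)
  \<comment> \<open>The combinations \<open>v X - u Y\<close>, \<open>w X - u T\<close> and
    \<open>w Y - v T\<close> of the frame are annihilated by \<open>g\<close>, hence
    tangent.\<close>
  have e1: "\<alpha> * v = \<beta> * u" using perp[of "v *\<^sub>R X_field p + (-u) *\<^sub>R Y_field p + 0 *\<^sub>R T_field p"]
    unfolding hin gin by (simp add: algebra_simps)
  have e2: "\<alpha> * w = \<gamma> * u" using perp[of "w *\<^sub>R X_field p + 0 *\<^sub>R Y_field p + (-u) *\<^sub>R T_field p"]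
    unfolding hin gin by (simp add: algebra_simps)
  have e3: "\<beta> * w = \<gamma> * v" using perp[of "0 *\<^sub>R X_field p + w *\<^sub>R Y_field p + (-v) *\<^sub>R T_field p"]
    unfolding hin gin by (simp add: algebra_simps)
  define D where "D = u\<^sup>2 + v\<^sup>2 + w\<^sup>2"
  have D: "D > 0" using heis_covector_pos[OF assms(3), of p] by (simp add: D_def u_def v_def w_def)
  define l where "l = \<alpha> * u + \<beta> * v + \<gamma> * w"
  have "l\<^sup>2 + (\<alpha> * v - \<beta> * u)\<^sup>2 + (\<alpha> * w - \<gamma> * u)\<^sup>2 + (\<beta> * w - \<gamma> * v)\<^sup>2 = (\<alpha>\<^sup>2 + \<beta>\<^sup>2 + \<gamma>\<^sup>2) * D"
    by (simp add: l_def D_def power2_eq_square algebra_simps)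
  then have "l\<^sup>2 = D" using e1 e2 e3 one by simp
  then have ls: "l = sqrt D \<or> l = - sqrt D" using D by (metis abs_if add.inverse_inverse real_sqrt_abs)
  have "\<alpha> * D = l * u" "\<beta> * D = l * v" "\<gamma> * D = l * w"
    unfolding D_def l_def power2_eq_square using e1 e2 e3 by algebra+
  then have ab: "\<alpha> = (l / D) * u" "\<beta> = (l / D) * v" "\<gamma> = (l / D) * w" using D by (simp_all add: field_simps)
  have n2: "n = (l / D) *\<^sub>R (u *\<^sub>R X_field p + v *\<^sub>R Y_field p + w *\<^sub>R T_field p)"
    unfolding n ab by (simp add: scaleR_add_right)
  have "sqrt D / D = 1 / sqrt D" using D by (simp add: real_div_sqrt field_simps)
  then have "l / D = 1 / sqrt D \<or> l / D = - (1 / sqrt D)" using ls by auto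
  then show ?thesis unfolding n2 heis_normal_def u_def[symmetric] v_def[symmetric] w_def[symmetric] D_def[symmetric]
    by (metis scaleR_minus_left)
qed

lemma eventually_sign_along_direction:
  fixes f :: "'a::real_normed_vector \<Rightarrow> real"
  assumes d: "(f has_derivative f') (at x)" and pos: "f' h > 0" and "f x = 0" "open N" "x \<in> N"
  shows "\<forall>\<^sub>F s in at_right (0::real). f (x + s *\<^sub>R h) > 0 \<and> f (x - s *\<^sub>R h) < 0 \<and> x + s *\<^sub>R h \<in> N \<and> x - s *\<^sub>R h \<in> N"
proof -
  have *: "((\<lambda>s. f (x + s *\<^sub>R k)) has_real_derivative f' k) (at 0)" for k
  proof -
    have "((\<lambda>s. x + s *\<^sub>R k) has_derivative (\<lambda>s. s *\<^sub>R k)) (at (0::real))"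
      by (auto intro!: derivative_eq_intros)
    then have "((\<lambda>s. f (x + s *\<^sub>R k)) has_derivative (\<lambda>s. f' (s *\<^sub>R k))) (at 0)"
      using has_derivative_compose[of "\<lambda>s. x + s *\<^sub>R k" "\<lambda>s. s *\<^sub>R k" 0 UNIV f f'] d by simp
    moreover have "(\<lambda>s. f' (s *\<^sub>R k)) = (*) (f' k)"
      by (auto simp: linear_cmul[OF has_derivative_linear[OF d]] mult.commute)
    ultimately show ?thesis by (simp add: has_field_derivative_def)
  qed
  obtain d1 where d1: "d1 > 0" "\<And>s. 0 < s \<Longrightarrow> s < d1 \<Longrightarrow> f (x + s *\<^sub>R h) > 0"
    using has_real_derivative_pos_inc_right[OF *[of h] pos] \<open>f x = 0\<close> by force
  have m: "f' (- h) < 0" using pos linear_neg[OF has_derivative_linear[OF d]] by simp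
  obtain d2 where d2: "d2 > 0" "\<And>s. 0 < s \<Longrightarrow> s < d2 \<Longrightarrow> f (x - s *\<^sub>R h) < 0"
    using has_real_derivative_neg_dec_right[OF *[of "-h"] m] \<open>f x = 0\<close> by force
  have ev: "\<forall>\<^sub>F s in at_right (0::real). x + s *\<^sub>R k \<in> N" for k
  proof -
    have "((\<lambda>s. x + s *\<^sub>R k) \<longlongrightarrow> x + 0 *\<^sub>R k) (at_right (0::real))" by (intro tendsto_intros)
    then show ?thesis by (rule topological_tendstoD) (use assms in auto)
  qed
  have "\<forall>\<^sub>F s in at_right (0::real). 0 < s \<and> s < min d1 d2"
    using d1 d2 by (auto simp: eventually_at_right intro!: exI[of _ "min d1 d2"])
  then show ?thesis using ev[of h] ev[of "-h"]
    by eventually_elim (use d1 d2 in auto)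
qed

text \<open>If the normal followed the gradient at \<open>p\<close> but opposed it at
  \<open>x\<close>, moving against the normal at \<open>p\<close> and along it at \<open>x\<close>
  would both lead into the side \<open>f < 0\<close>. That connected set avoids \<open>M\<close>,
  yet it would contain an inside and an outside point.\<close>

lemma outward_normal_constant_sign:
  fixes M :: "(real^3) set"
  assumes out: "outward_unit_normal M \<nu>" and "open N"
    and der: "\<And>x. x \<in> N \<Longrightarrow> (f has_derivative (\<lambda>h. G x \<bullet> h)) (at x)"
    and G0: "\<And>x. x \<in> N \<Longrightarrow> G x \<noteq> 0" and MN: "M \<inter> N = {x \<in> N. f x = 0}"
    and con: "connected {x \<in> N. f x > 0}" "connected {x \<in> N. f x < 0}"
    and T: "\<And>x. x \<in> M \<inter> N \<Longrightarrow> tangent_space M x = {v. G x \<bullet> v = 0}"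
    and p: "p \<in> M \<inter> N" "\<nu> p = heis_normal (G p) p"
    and x: "x \<in> M \<inter> N"
  shows "\<nu> x = heis_normal (G x) x"
proof (rule ccontr)
  assume neq: "\<nu> x \<noteq> heis_normal (G x) x"
  have un: "unit_normal M x (\<nu> x)" using out x by (auto simp: outward_unit_normal_def)
  have nx: "\<nu> x = - heis_normal (G x) x" using unit_normal_cases[OF un T[OF x] G0] x neq by blast
  have io: "\<forall>\<^sub>F s in at_right (0::real). q + s *\<^sub>R \<nu> q \<in> outside M \<and> q - s *\<^sub>R \<nu> q \<in> inside M"
    if "q \<in> M" for q using out that by (auto simp: outward_unit_normal_def)
  have sg: "\<forall>\<^sub>F s in at_right (0::real). f (q + s *\<^sub>R heis_normal (G q) q) > 0 \<and> f (q - s *\<^sub>R heis_normal (G q) q) < 0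
      \<and> q + s *\<^sub>R heis_normal (G q) q \<in> N \<and> q - s *\<^sub>R heis_normal (G q) q \<in> N" if "q \<in> M \<inter> N" for q
    using that MN G0[of q] der[of q] \<open>open N\<close>
    by (intro eventually_sign_along_direction[where f'="\<lambda>h. G q \<bullet> h"] inner_heis_normal_pos) auto
  have "\<forall>\<^sub>F s in at_right (0::real). \<exists>y. y \<in> {x \<in> N. f x < 0} \<and> y \<in> inside M"
    using sg[OF p(1)] io[OF IntD1[OF p(1)]] unfolding p(2) by eventually_elim blast
  then obtain y where y: "y \<in> {x \<in> N. f x < 0}" "y \<in> inside M"
    using eventually_happens'[OF trivial_limit_at_right_real] by blast
  have "\<forall>\<^sub>F s in at_right (0::real). \<exists>y. y \<in> {x \<in> N. f x < 0} \<and> y \<in> outside M"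
    using sg[OF x] io[OF IntD1[OF x]] unfolding nx by eventually_elim auto
  then obtain y' where y': "y' \<in> {x \<in> N. f x < 0}" "y' \<in> outside M"
    using eventually_happens'[OF trivial_limit_at_right_real] by blast
  have "f z = 0" if "z \<in> M" "z \<in> N" for z using IntI[OF that] unfolding MN by simp
  then have "{x \<in> N. f x < 0} \<subseteq> - M" by fastforce
  then have "connected_component (- M) y y'"
    using con(2) y(1) y'(1) unfolding connected_component_def by blast
  then have "y' \<in> inside M" using inside_same_component y(2) by blast
  then show False using y'(2) inside_Int_outside by blast
qed

text \<open>The sign of the defining function is chosen so that its gradient gives the outward
  normal at \<open>p\<close>; connectedness of the sides then carries this choice to all of
  \<open>M \<inter> U\<close>.\<close>

lemma outward_surface_local:
  assumes sm: "smooth_surface M" and out: "outward_unit_normal M \<nu>" and p: "p \<in> M" and W: "open W" "p \<in> W"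
  obtains U f G where "open U" "p \<in> U" "U \<subseteq> W"
    "\<And>x. x \<in> U \<Longrightarrow> (f has_derivative (\<lambda>h. G x \<bullet> h)) (at x)"
    "\<And>x. x \<in> U \<Longrightarrow> G differentiable (at x)" "\<And>x. x \<in> U \<Longrightarrow> G x \<noteq> 0"
    "M \<inter> U = {x \<in> U. f x = 0}" "connected (M \<inter> U - {p})" "p islimpt M"
    "\<And>x. x \<in> M \<inter> U \<Longrightarrow> tangent_space M x = {v. G x \<bullet> v = 0}"
    "\<And>x. x \<in> M \<inter> U \<Longrightarrow> \<nu> x = heis_normal (G x) x"
proof -
  have "hypersurface_at 2 M p" using sm p by (simp add: smooth_surface_def)
  obtain U0 f G where 0: "open U0" "p \<in> U0" "\<And>x. x \<in> U0 \<Longrightarrow> (f has_derivative (\<lambda>h. G x \<bullet> h)) (at x)"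
    "\<And>x. x \<in> U0 \<Longrightarrow> G differentiable (at x)" "\<And>x. x \<in> U0 \<Longrightarrow> G x \<noteq> 0" "M \<inter> U0 = {x \<in> U0. f x = 0}"
    by (rule hypersurface_at_2_level_set[OF \<open>hypersurface_at 2 M p\<close>]) (rule that)
  let ?U = "U0 \<inter> W"
  have cG: "continuous_on ?U G"
    using 0(4) by (simp add: continuous_at_imp_continuous_on differentiable_imp_continuous_within)
  have fp: "f p = 0" using 0(2,6) p by auto
  obtain N where N: "open N" "p \<in> N" "N \<subseteq> ?U" "connected {x \<in> N. f x > 0}" "connected {x \<in> N. f x < 0}"
    "connected ({x \<in> N. f x = 0} - {p})" "p islimpt {x \<in> N. f x = 0}"
  proof (rule level_set_local_topology[of ?U p f G])
    show "open ?U" using 0 W by auto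
  qed (use 0 W fp cG in auto)
  have MN: "M \<inter> N = {x \<in> N. f x = 0}" using 0(6) N(3) by auto
  have T: "tangent_space M x = {v. G x \<bullet> v = 0}" if "x \<in> M \<inter> N" for x
  proof (rule level_set_tangent_space[of N])
    show "continuous_on N G" using cG N(3) continuous_on_subset by blast
  qed (use N that 0 MN in auto)
  have un: "unit_normal M p (\<nu> p)" using out p by (simp add: outward_unit_normal_def)
  have "p \<in> M \<inter> N" using p N by auto
  have "\<nu> p = heis_normal (G p) p \<or> \<nu> p = heis_normal (- G p) p"
    using unit_normal_cases[OF un T] p N(2) 0(2,5) by (simp add: heis_normal_minus)
  then show thesis
  proof
    assume np: "\<nu> p = heis_normal (G p) p"
    show thesis
    proof
      show "\<nu> x = heis_normal (G x) x" if "x \<in> M \<inter> N" for x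
        by (rule outward_normal_constant_sign[OF out N(1) _ _ MN N(4,5) T \<open>p \<in> M \<inter> N\<close> np that]) (use N(3) 0 in auto)
      show "p islimpt M" using N(7) unfolding MN[symmetric] by (meson inf_le1 islimpt_subset)
    qed (use N 0 MN T in auto)
  next
    assume np: "\<nu> p = heis_normal (- G p) p"
    have MN': "M \<inter> N = {x \<in> N. - f x = 0}" using MN by auto
    have T': "tangent_space M x = {v. - G x \<bullet> v = 0}" if "x \<in> M \<inter> N" for x using T[OF that] by auto
    have der': "((\<lambda>x. - f x) has_derivative (\<lambda>h. - G x \<bullet> h)) (at x)" if "x \<in> N" for x
      using has_derivative_minus[OF 0(3)] that N(3) by auto
    show thesis
    proof
      show "\<nu> x = heis_normal (- G x) x" if "x \<in> M \<inter> N" for x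
        by (rule outward_normal_constant_sign[OF out N(1) der' _ MN' _ _ T' \<open>p \<in> M \<inter> N\<close> np that]) (use N 0 in auto)
      show "p islimpt M" using N(7) unfolding MN[symmetric] by (meson inf_le1 islimpt_subset)
      show "((\<lambda>x. - f x) has_derivative (\<lambda>h. - G x \<bullet> h)) (at x)" if "x \<in> N" for x using der' that .
      show "(\<lambda>x. - G x) differentiable (at x)" if "x \<in> N" for x
        using 0(4) that N(3) by (auto intro: differentiable_minus)
    qed (use N 0 MN' T' MN in auto)
  qed
qed

section \<open>Horizontal curvature along leaves\<close>

text \<open>The contact form dt + 2y dx - 2x dy, whose kernel is the horizontal space.\<close>

definition contact :: "real^3 \<Rightarrow> real^3 \<Rightarrow> real" where
  "contact p v = v$3 + 2 * p$2 * v$1 - 2 * p$1 * v$2"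

lemma heis_inner_contact:
  "heis_inner p v w = v$1 * w$1 + v$2 * w$2 + contact p v * contact p w"
  by (simp add: heis_inner_def contact_def)

lemma heis_gram_mult: "heis_inner p v w = v \<bullet> (heis_gram p *v w)"
  by (simp add: heis_gram_def heis_inner_def inner_vec_def matrix_vector_mult_def sum_3 axis_def algebra_simps)

lemma has_derivative_vec_nth [derivative_intros]:
  "(g has_derivative g') F \<Longrightarrow> ((\<lambda>x. g x $ i) has_derivative (\<lambda>h. g' h $ i)) F"
  by (rule bounded_linear.has_derivative[OF bounded_linear_vec_nth])

lemma partial_heis_gram:
  "partial i (\<lambda>q. heis_gram q $ j $ l) p =
     (2 * axis i 1 $ 2 * axis j 1 $ 1 - 2 * axis i 1 $ 1 * axis j 1 $ 2) * contact p (axis l 1)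
     + contact p (axis j 1) * (2 * axis i 1 $ 2 * axis l 1 $ 1 - 2 * axis i 1 $ 1 * axis l 1 $ 2)"
proof -
  have "((\<lambda>q. heis_gram q $ j $ l) has_derivative
     (\<lambda>h. (2 * h $ 2 * axis j 1 $ 1 - 2 * h $ 1 * axis j 1 $ 2) * contact p (axis l 1)
     + contact p (axis j 1) * (2 * h $ 2 * axis l 1 $ 1 - 2 * h $ 1 * axis l 1 $ 2))) (at p)"
    unfolding heis_gram_def heis_inner_contact contact_def
    by (auto intro!: derivative_eq_intros simp: fun_eq_iff algebra_simps)
  from frechet_derivative_at[OF this] show ?thesis
    by (simp add: partial_def fun_eq_iff)
qed

lemma invertible_heis_gram: "invertible (heis_gram p)"
proof -
  have "det (heis_gram p) = 1"
    by (simp add: det_3 heis_gram_def heis_inner_contact contact_def axis_def algebra_simps)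
  then show ?thesis by (simp add: invertible_det_nz)
qed

lemma matrix_inv_right: "invertible A \<Longrightarrow> A ** matrix_inv A = mat 1"
  unfolding invertible_def matrix_inv_def by (rule someI2_ex) auto

text \<open>By the Koszul formula the left-hand side is \<open>1/2\<close> times the derivative of \<open>g(e, e)\<close> along \<open>w\<close>,
  for the constant extension of \<open>e\<close>; it vanishes since the contact form enters \<open>g\<close> quadratically.\<close>

lemma christoffel_heis_gram_horizontal:
  assumes "contact p e = 0"
  shows "heis_inner p (\<chi> k. \<Sum>i\<in>UNIV. \<Sum>j\<in>UNIV. christoffel heis_gram p k i j * e $ i * w $ j) e = 0"
proof -
  define S where "S l i j = partial i (\<lambda>q. heis_gram q $ j $ l) p + partial j (\<lambda>q. heis_gram q $ i $ l) p
         - partial l (\<lambda>q. heis_gram q $ i $ j) p" for i j l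
  define L :: "real^3" where "L = (\<chi> l. (\<Sum>i\<in>UNIV. \<Sum>j\<in>UNIV. S l i j * e $ i * w $ j) / 2)"
  let ?V = "\<chi> k. \<Sum>i\<in>UNIV. \<Sum>j\<in>UNIV. christoffel heis_gram p k i j * e $ i * w $ j"
  \<comment> \<open>The Christoffel symbols carry the inverse Gram matrix; pairing with the metric
    cancels it and leaves the symbols of the first kind, collected in \<open>L\<close>.\<close>
  have V: "?V = matrix_inv (heis_gram p) *v L"
    by (simp add: vec_eq_iff matrix_vector_mult_def L_def christoffel_def S_def[symmetric] sum_3
        algebra_simps add_divide_distrib)
  have "heis_inner p ?V e = heis_inner p e ?V" by (simp add: heis_inner_def algebra_simps)
  also have "\<dots> = e \<bullet> L"
    unfolding heis_gram_mult V matrix_vector_mul_assoc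
    by (simp add: matrix_inv_right invertible_heis_gram)
  also have "\<dots> = 0"
  proof -
    have e3: "e $ 3 = 2 * p$1 * e$2 - 2 * p$2 * e$1" using assms by (simp add: contact_def)
    show ?thesis
      unfolding inner_vec_def L_def S_def partial_heis_gram contact_def
      by (simp add: sum_3 axis_def e3) (simp add: algebra_simps flip: add_divide_distrib)
  qed
  finally show ?thesis .
qed

section \<open>The horizontal normal and its derivative\<close>

lemma horizontal_proj_frame: "horizontal_proj p v = v$1 *\<^sub>R X_field p + v$2 *\<^sub>R Y_field p"
  by (simp add: horizontal_proj_def heis_inner_contact contact_def heis_frame_components)

lemma heis_norm_horizontal: "heis_norm p (a *\<^sub>R X_field p + b *\<^sub>R Y_field p) = sqrt (a\<^sup>2 + b\<^sup>2)"
  by (simp add: heis_norm_def heis_inner_contact contact_def heis_frame_components power2_eq_square)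

lemma horizontal_normal_frame:
  "horizontal_normal \<nu> p = (\<nu> p $ 1 / sqrt ((\<nu> p $ 1)\<^sup>2 + (\<nu> p $ 2)\<^sup>2)) *\<^sub>R X_field p
     + (\<nu> p $ 2 / sqrt ((\<nu> p $ 1)\<^sup>2 + (\<nu> p $ 2)\<^sup>2)) *\<^sub>R Y_field p"
  by (simp add: horizontal_normal_def horizontal_proj_frame heis_norm_horizontal scaleR_add_right)

text \<open>Equality can fail only where the horizontal projection vanishes; there division by zero
  gives the zero vector. An inequality at every point suffices for the maximum argument in
  \<open>leaf_curve\<close>.\<close>

lemma horizontal_normal_norm_le:
  "(horizontal_normal \<nu> p $ 1)\<^sup>2 + (horizontal_normal \<nu> p $ 2)\<^sup>2 \<le> 1"
  by (simp add: horizontal_normal_frame heis_frame_components power_divide flip: add_divide_distrib)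

lemma eta_frame:
  "eta \<nu> p = horizontal_normal \<nu> p $ 2 *\<^sub>R X_field p - horizontal_normal \<nu> p $ 1 *\<^sub>R Y_field p"
  by (simp add: eta_def J_map_def heis_inner_contact contact_def heis_frame_components)

lemma contact_eta: "contact p (eta \<nu> p) = 0"
  by (simp add: eta_frame contact_def heis_frame_components)

text \<open>As \<eta> is horizontal, the Christoffel part of the connection contributes nothing and
  the contact part of the metric drops out, leaving the coordinate derivative of the horizontal
  normal.\<close>

lemma horizontal_mean_curvature_eq:
  "horizontal_mean_curvature M \<nu> p =
     frechet_derivative (horizontal_normal \<nu>) (at p within M) (eta \<nu> p) $ 1 * horizontal_normal \<nu> p $ 2
   - frechet_derivative (horizontal_normal \<nu>) (at p within M) (eta \<nu> p) $ 2 * horizontal_normal \<nu> p $ 1"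
proof -
  have add: "heis_inner p (v + w) e = heis_inner p v e + heis_inner p w e" for v w e
    by (simp add: heis_inner_def algebra_simps)
  show ?thesis
    unfolding horizontal_mean_curvature_def covariant_deriv_def add
      christoffel_heis_gram_horizontal[OF contact_eta]
    by (simp add: heis_inner_contact contact_eta) (simp add: eta_frame heis_frame_components)
qed

lemma heis_normal_components:
  "heis_normal g p $ 1 = (g \<bullet> X_field p) / sqrt ((g \<bullet> X_field p)\<^sup>2 + (g \<bullet> Y_field p)\<^sup>2 + (g \<bullet> T_field p)\<^sup>2)"
  "heis_normal g p $ 2 = (g \<bullet> Y_field p) / sqrt ((g \<bullet> X_field p)\<^sup>2 + (g \<bullet> Y_field p)\<^sup>2 + (g \<bullet> T_field p)\<^sup>2)"
  by (simp_all add: heis_normal_def heis_frame_components)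

lemma horizontal_normal_of_heis_normal:
  fixes g :: "real^3"
  assumes "\<nu> p = heis_normal g p" "g \<noteq> 0"
  shows "horizontal_normal \<nu> p = (1 / sqrt ((g \<bullet> X_field p)\<^sup>2 + (g \<bullet> Y_field p)\<^sup>2)) *\<^sub>R
     ((g \<bullet> X_field p) *\<^sub>R X_field p + (g \<bullet> Y_field p) *\<^sub>R Y_field p)"
proof -
  define u v D where "u = g \<bullet> X_field p" and "v = g \<bullet> Y_field p"
    and "D = (g \<bullet> X_field p)\<^sup>2 + (g \<bullet> Y_field p)\<^sup>2 + (g \<bullet> T_field p)\<^sup>2"
  have D: "D > 0" using heis_covector_pos[OF assms(2)] by (simp add: D_def)
  have 1: "\<nu> p $ 1 = u / sqrt D" "\<nu> p $ 2 = v / sqrt D"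
    by (simp_all add: assms(1) heis_normal_components u_def v_def D_def)
  have "(\<nu> p $ 1)\<^sup>2 + (\<nu> p $ 2)\<^sup>2 = (u\<^sup>2 + v\<^sup>2) / D"
    using D by (simp add: 1 power_divide add_divide_distrib)
  then have 2: "sqrt ((\<nu> p $ 1)\<^sup>2 + (\<nu> p $ 2)\<^sup>2) = sqrt (u\<^sup>2 + v\<^sup>2) / sqrt D"
    by (simp add: real_sqrt_divide)
  have "sqrt D > 0" using D by simp
  then show ?thesis
    unfolding horizontal_normal_frame 2
    unfolding 1 u_def[symmetric] v_def[symmetric]
    by (simp add: scaleR_add_right)
qed

text \<open>If \<open>g\<close> annihilates \<open>X\<close> and \<open>Y\<close> it cannot
  annihilate \<open>T\<close>, so on the kernel of \<open>g\<close> the contact form vanishes and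
  the tangent plane is horizontal.\<close>

lemma characteristic_iff:
  assumes "p \<in> M" "tangent_space M p = {v. g \<bullet> v = 0}" "g \<noteq> 0"
  shows "characteristic M p \<longleftrightarrow> g \<bullet> X_field p = 0 \<and> g \<bullet> Y_field p = 0"
proof
  assume "characteristic M p"
  then have "horizontal_space p = {v. g \<bullet> v = 0}" using assms by (simp add: characteristic_def)
  moreover have "X_field p \<in> horizontal_space p" "Y_field p \<in> horizontal_space p"
    by (simp_all add: horizontal_space_def span_base)
  ultimately show "g \<bullet> X_field p = 0 \<and> g \<bullet> Y_field p = 0" by blast
next
  assume uv: "g \<bullet> X_field p = 0 \<and> g \<bullet> Y_field p = 0"
  have w: "g \<bullet> T_field p \<noteq> 0" using heis_covector_pos[OF assms(3), of p] uv by auto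
  have "horizontal_space p \<subseteq> {v. g \<bullet> v = 0}"
    unfolding horizontal_space_def
    by (rule span_minimal) (use uv in \<open>auto simp: subspace_hyperplane\<close>)
  moreover have "v \<in> horizontal_space p" if "g \<bullet> v = 0" for v
  proof -
    have v: "v = v$1 *\<^sub>R X_field p + v$2 *\<^sub>R Y_field p + contact p v *\<^sub>R T_field p"
      unfolding contact_def by (rule heis_frame_expansion)
    have "g \<bullet> v = contact p v * (g \<bullet> T_field p)"
      by (subst v) (simp add: inner_add_right uv)
    then have "contact p v = 0" using that w by simp
    then have "v = v$1 *\<^sub>R X_field p + v$2 *\<^sub>R Y_field p" using v by simp
    moreover have "v$1 *\<^sub>R X_field p + v$2 *\<^sub>R Y_field p \<in> horizontal_space p"
      unfolding horizontal_space_def by (intro span_add span_scale span_base) auto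
    ultimately show ?thesis by metis
  qed
  ultimately show "characteristic M p" using assms by (auto simp: characteristic_def)
qed

lemma differentiable_sqrt:
  assumes "h differentiable (at x within S)" "h x > 0"
  shows "(\<lambda>x. sqrt (h x)) differentiable (at x within S)"
proof -
  obtain h' where "(h has_derivative h') (at x within S)" using assms(1) by (auto simp: differentiable_def)
  from has_derivative_real_sqrt[OF _ this] assms(2) show ?thesis by (auto simp: differentiable_def)
qed

lemma X_field_affine: "X_field p = axis 1 1 - (2 * p$2) *\<^sub>R axis 3 1"
  and Y_field_affine: "Y_field p = axis 2 1 + (2 * p$1) *\<^sub>R axis 3 1"
  by (simp_all add: X_field_def Y_field_def vec_eq_iff forall_3 vector_3 axis_def)

text \<open>Away from characteristic points the pair \<open>(g \<bullet> X, g \<bullet> Y)\<close>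
  is nonzero, so normalizing it gives an ambient field, differentiable at \<open>p\<close>, that
  agrees with the horizontal normal on \<open>M\<close> near \<open>p\<close>.\<close>

lemma horizontal_normal_regular:
  assumes sm: "smooth_surface M" and out: "outward_unit_normal M \<nu>" and p: "p \<in> M" and nc: "\<not> characteristic M p"
  shows "horizontal_normal \<nu> differentiable (at p within M)"
    and "(horizontal_normal \<nu> p $ 1)\<^sup>2 + (horizontal_normal \<nu> p $ 2)\<^sup>2 = 1"
    and "- eta \<nu> p \<in> tangent_space M p"
proof -
  obtain U f G where U: "open U" "p \<in> U" "U \<subseteq> UNIV"
    "\<And>x. x \<in> U \<Longrightarrow> (f has_derivative (\<lambda>h. G x \<bullet> h)) (at x)"
    "\<And>x. x \<in> U \<Longrightarrow> G differentiable (at x)" "\<And>x. x \<in> U \<Longrightarrow> G x \<noteq> 0"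
    "M \<inter> U = {x \<in> U. f x = 0}" "connected (M \<inter> U - {p})" "p islimpt M"
    "\<And>x. x \<in> M \<inter> U \<Longrightarrow> tangent_space M x = {v. G x \<bullet> v = 0}"
    "\<And>x. x \<in> M \<inter> U \<Longrightarrow> \<nu> x = heis_normal (G x) x"
    by (rule outward_surface_local[OF sm out p open_UNIV UNIV_I]) (rule that)
  define u v where "u x = G x \<bullet> X_field x" and "v x = G x \<bullet> Y_field x" for x
  define F where "F x = (1 / sqrt ((u x)\<^sup>2 + (v x)\<^sup>2)) *\<^sub>R (u x *\<^sub>R X_field x + v x *\<^sub>R Y_field x)" for x
  have hn: "horizontal_normal \<nu> x = F x" if "x \<in> M \<inter> U" for x
    using horizontal_normal_of_heis_normal[of \<nu> x "G x"] U(6,11) that by (simp add: F_def u_def v_def)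
  have pMU: "p \<in> M \<inter> U" using p U(2) by simp
  have T: "tangent_space M p = {v. G p \<bullet> v = 0}" using U(10) pMU .
  have "u p \<noteq> 0 \<or> v p \<noteq> 0"
    using nc characteristic_iff[OF p T U(6)[OF U(2)]] by (simp add: u_def v_def)
  then have s: "(u p)\<^sup>2 + (v p)\<^sup>2 > 0" by (simp add: sum_power2_gt_zero_iff)
  have nth: "(\<lambda>x::real^3. x $ i) differentiable (at p)" for i
    by (rule bounded_linear_imp_differentiable[OF bounded_linear_vec_nth])
  have G: "G differentiable (at p)" using U(2,5) by blast
  have inner: "(\<lambda>x. G x \<bullet> k x) differentiable (at p)" if "k differentiable (at p)" for k
    using G that unfolding differentiable_def by (auto intro: has_derivative_inner)
  have XY: "X_field differentiable (at p)" "Y_field differentiable (at p)"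
    unfolding X_field_affine[abs_def] Y_field_affine[abs_def]
    by (intro derivative_intros nth)+
  have uv: "u differentiable (at p)" "v differentiable (at p)"
    unfolding u_def[abs_def] v_def[abs_def] by (intro inner XY)+
  have "F differentiable (at p)"
    unfolding F_def[abs_def]
    by (intro derivative_intros differentiable_sqrt uv XY) (use s in auto)
  then have Fd: "F differentiable (at p within M)" by (rule differentiable_at_withinI)
  obtain e where e: "e > 0" "ball p e \<subseteq> U" using U(1,2) open_contains_ball by blast
  show "horizontal_normal \<nu> differentiable (at p within M)"
    by (rule differentiable_transform_within[OF Fd e(1) p]) (use e(2) hn in \<open>auto simp: subset_iff dist_commute\<close>)
  have c: "horizontal_normal \<nu> p $ 1 = u p / sqrt ((u p)\<^sup>2 + (v p)\<^sup>2)"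
    "horizontal_normal \<nu> p $ 2 = v p / sqrt ((u p)\<^sup>2 + (v p)\<^sup>2)"
    by (simp_all add: hn[OF pMU] F_def heis_frame_components)
  show "(horizontal_normal \<nu> p $ 1)\<^sup>2 + (horizontal_normal \<nu> p $ 2)\<^sup>2 = 1"
    using less_imp_neq[OF s] by (simp add: c power_divide del: sum_power2_eq_zero_iff flip: add_divide_distrib)
  have "G p \<bullet> - eta \<nu> p = 0"
    by (simp add: eta_frame c inner_diff_right flip: u_def v_def)
  then show "- eta \<nu> p \<in> tangent_space M p" using T by simp
qed

lemma tangent_curve_vector:
  assumes "v \<in> tangent_space M p" "p \<in> M"
  obtains \<gamma> where "\<gamma> (0::real) = p" "\<And>s. \<gamma> s \<in> M" "(\<gamma> has_derivative (\<lambda>s. s *\<^sub>R v)) (at 0)"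
proof -
  obtain \<gamma>0 where \<gamma>0: "\<gamma>0 0 = p" "\<forall>\<^sub>F s in nhds (0::real). \<gamma>0 s \<in> M" "(\<gamma>0 has_vector_derivative v) (at 0)"
    using assms(1) by (auto simp: tangent_space_def)
  \<comment> \<open>A tangent curve need lie in \<open>M\<close> only near 0; resetting it to
    \<open>p\<close> elsewhere keeps it in \<open>M\<close> for every parameter without changing its
    derivative at 0.\<close>
  define \<gamma> where "\<gamma> s = (if \<gamma>0 s \<in> M then \<gamma>0 s else p)" for s
  have \<gamma>: "\<gamma> 0 = p" "\<gamma> s \<in> M" for s using assms(2) \<gamma>0(1) by (auto simp: \<gamma>_def)
  have ev: "\<forall>\<^sub>F s in at 0. \<gamma>0 s = \<gamma> s"
    using \<gamma>0(2) by (auto simp: eventually_nhds_conv_at \<gamma>_def elim: eventually_mono)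
  have "(\<gamma> has_derivative (\<lambda>s. s *\<^sub>R v)) (at 0)"
    by (rule has_derivative_transform_eventually[OF _ ev])
      (use \<gamma>0 \<gamma> in \<open>auto simp: has_vector_derivative_def\<close>)
  then show thesis using that[of \<gamma>] \<gamma> by blast
qed

lemma vec_nth_has_real_derivative:
  "(k has_derivative (\<lambda>s. s *\<^sub>R v)) (at x) \<Longrightarrow> ((\<lambda>s. k s $ i) has_real_derivative v $ i) (at x)"
  using has_derivative_vec_nth[of k "\<lambda>s. s *\<^sub>R v" "at x" i] by (simp add: has_field_derivative_def mult_commute_abs)

lemma tangent_curve:
  assumes "v \<in> tangent_space M p" "p \<in> M"
  obtains \<gamma> where "\<gamma> (0::real) = p" "\<And>s. \<gamma> s \<in> M" "\<And>i. ((\<lambda>s. \<gamma> s $ i) has_real_derivative v $ i) (at 0)"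
  by (rule tangent_curve_vector[OF assms], rule that) (assumption | erule vec_nth_has_real_derivative)+

text \<open>A curve in \<open>M\<close> with initial velocity -\<eta> suffices, by the chain rule at
  the single parameter 0. There (a, b) turns like a unit vector, so its derivative is a multiple of
  (-b, a), and the curvature is that multiple.\<close>

lemma leaf_curve:
  assumes sm: "smooth_surface M" and out: "outward_unit_normal M \<nu>" and p: "p \<in> M" and nc: "\<not> characteristic M p"
  defines "a \<equiv> \<lambda>q. horizontal_normal \<nu> q $ 1" and "b \<equiv> \<lambda>q. horizontal_normal \<nu> q $ 2"
    and "H \<equiv> horizontal_mean_curvature M \<nu> p"
  obtains \<gamma> where "\<gamma> (0::real) = p" "\<And>s. \<gamma> s \<in> M"
    "((\<lambda>s. \<gamma> s $ 1) has_real_derivative - b p) (at 0)"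
    "((\<lambda>s. \<gamma> s $ 2) has_real_derivative a p) (at 0)"
    "((\<lambda>s. \<gamma> s $ 3) has_real_derivative 2 * (p$1 * a p + p$2 * b p)) (at 0)"
    "((\<lambda>s. a (\<gamma> s)) has_real_derivative - b p * H) (at 0)"
    "((\<lambda>s. b (\<gamma> s)) has_real_derivative a p * H) (at 0)"
proof -
  note reg = horizontal_normal_regular[OF sm out p nc]
  define W where "W = horizontal_normal \<nu>"
  define D where "D = frechet_derivative W (at p within M)"
  define t where "t = - eta \<nu> p"
  obtain \<gamma> where \<gamma>: "\<gamma> (0::real) = p" "\<And>s. \<gamma> s \<in> M" and d\<gamma>: "(\<gamma> has_derivative (\<lambda>s. s *\<^sub>R t)) (at 0)"
    by (rule tangent_curve_vector[OF reg(3)[folded t_def] p]) (rule that)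
  have dW: "(W has_derivative D) (at p within M)"
    using reg(1) unfolding D_def W_def by (simp add: frechet_derivative_works)
  have "(W has_derivative D) (at (\<gamma> 0) within range \<gamma>)"
    unfolding \<gamma>(1) by (rule has_derivative_subset[OF dW]) (use \<gamma>(2) in auto)
  then have dW\<gamma>: "((\<lambda>s. W (\<gamma> s)) has_derivative (\<lambda>s. D (s *\<^sub>R t))) (at 0)"
    using has_derivative_in_compose[OF d\<gamma>] by blast
  note comp = vec_nth_has_real_derivative
  have "D (s *\<^sub>R t) = s *\<^sub>R D t" for s
    using linear_cmul[OF has_derivative_linear[OF dW]] .
  then have dW\<gamma>': "((\<lambda>s. W (\<gamma> s)) has_derivative (\<lambda>s. s *\<^sub>R D t)) (at 0)" using dW\<gamma> by simp
  have t: "t $ 1 = - b p" "t $ 2 = a p" "t $ 3 = 2 * (p$1 * a p + p$2 * b p)"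
    by (simp_all add: t_def eta_frame heis_frame_components a_def b_def algebra_simps)
  have Deta: "D (eta \<nu> p) = - D t"
    using linear_neg[OF has_derivative_linear[OF dW], of t] by (simp add: t_def)
  have H: "H = a p * D t $ 2 - b p * D t $ 1"
    unfolding H_def horizontal_mean_curvature_eq W_def[symmetric] D_def[symmetric] Deta
    by (simp add: a_def b_def W_def algebra_simps)
  have da: "((\<lambda>s. a (\<gamma> s)) has_real_derivative D t $ 1) (at 0)"
    and db: "((\<lambda>s. b (\<gamma> s)) has_real_derivative D t $ 2) (at 0)"
    using comp[OF dW\<gamma>'] by (simp_all add: a_def b_def W_def)
  have one: "(a p)\<^sup>2 + (b p)\<^sup>2 = 1" using reg(2) by (simp add: a_def b_def)
  \<comment> \<open>The length of (a, b) never exceeds 1 and equals 1 at \<open>p\<close>, so it has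
    a maximum at 0; hence the derivative of (a, b) is orthogonal to (a, b).\<close>
  have "((\<lambda>s. (a (\<gamma> s))\<^sup>2 + (b (\<gamma> s))\<^sup>2) has_real_derivative 2 * (a p * D t $ 1 + b p * D t $ 2)) (at 0)"
    by (auto intro!: derivative_eq_intros da db simp: \<gamma>(1))
  moreover have "\<forall>s. \<bar>0 - s\<bar> < 1 \<longrightarrow> (a (\<gamma> s))\<^sup>2 + (b (\<gamma> s))\<^sup>2 \<le> (a (\<gamma> 0))\<^sup>2 + (b (\<gamma> 0))\<^sup>2"
    using one horizontal_normal_norm_le by (simp add: \<gamma>(1) a_def b_def)
  ultimately have "2 * (a p * D t $ 1 + b p * D t $ 2) = 0"
    by (rule DERIV_local_max[OF _ zero_less_one])
  then have orth: "a p * D t $ 1 + b p * D t $ 2 = 0" by simp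
  have "D t $ 1 = ((a p)\<^sup>2 + (b p)\<^sup>2) * D t $ 1" using one by simp
  also have "\<dots> = a p * (a p * D t $ 1 + b p * D t $ 2) - b p * H"
    unfolding H by (simp add: power2_eq_square algebra_simps)
  finally have D1: "D t $ 1 = - b p * H" using orth by simp
  have "D t $ 2 = ((a p)\<^sup>2 + (b p)\<^sup>2) * D t $ 2" using one by simp
  also have "\<dots> = b p * (a p * D t $ 1 + b p * D t $ 2) + a p * H"
    unfolding H by (simp add: power2_eq_square algebra_simps)
  finally have D2: "D t $ 2 = a p * H" using orth by simp
  show thesis
  proof
    show "\<gamma> 0 = p" "\<gamma> s \<in> M" for s using \<gamma> by auto
    show "((\<lambda>s. \<gamma> s $ 1) has_real_derivative - b p) (at 0)"
      "((\<lambda>s. \<gamma> s $ 2) has_real_derivative a p) (at 0)"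
      "((\<lambda>s. \<gamma> s $ 3) has_real_derivative 2 * (p$1 * a p + p$2 * b p)) (at 0)"
      using comp[OF d\<gamma>] t by metis+
    show "((\<lambda>s. a (\<gamma> s)) has_real_derivative - b p * H) (at 0)"
      "((\<lambda>s. b (\<gamma> s)) has_real_derivative a p * H) (at 0)"
      using da db D1 D2 by simp_all
  qed
qed

section \<open>The first integral\<close>

definition rad :: "real^3 \<Rightarrow> real" where
  "rad p = sqrt ((p$1)\<^sup>2 + (p$2)\<^sup>2)"

lemma rad_nonneg: "rad p \<ge> 0" and rad_sq: "(rad p)\<^sup>2 = (p$1)\<^sup>2 + (p$2)\<^sup>2"
  by (simp_all add: rad_def)

lemma rad_eq_0_iff: "rad p = 0 \<longleftrightarrow> p$1 = 0 \<and> p$2 = 0"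
  by (simp add: rad_def)

lemma continuous_rad: "continuous_on S rad"
  unfolding rad_def[abs_def] by (intro continuous_intros)

lemma rad_le_norm: "rad p \<le> norm p"
  unfolding rad_def norm_eq_sqrt_inner by (simp add: inner_vec_def sum_3 power2_eq_square)

lemma max_along_curve_derivative:
  fixes \<Psi> :: "'a \<Rightarrow> real"
  assumes "\<And>q. q \<in> M \<Longrightarrow> \<Psi> q \<le> \<Psi> p" "\<gamma> (0::real) = p" "\<And>s. \<gamma> s \<in> M"
    "((\<lambda>s. \<Psi> (\<gamma> s)) has_real_derivative d) (at 0)"
  shows "d = 0"
  by (rule DERIV_local_max[OF assms(4) zero_less_one]) (use assms in auto)

text \<open>The derivative along a leaf of \<open>c t / 2 + h / r + \<epsilon> h m\<close>: the first two summands contribute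
  only \<open>m\<^sup>2 / r\<^sup>3\<close>, which may vanish.\<close>

lemma leaf_derivative_pos:
  fixes r m c K :: real
  assumes r: "0 < r" "r \<le> K" and "c \<noteq> 0" and \<epsilon>: "\<epsilon> = c / (1 + 4 * c\<^sup>2 * K ^ 4)"
  shows "m\<^sup>2 / r ^ 3 + \<epsilon> * (m + c * r ^ 3 - 2 * c * r * m\<^sup>2) > 0"
proof -
  \<comment> \<open>\<open>N\<close> bounds \<open>4 * c\<^sup>2 * r ^ 4\<close>, so that the
    negative term \<open>- 2 * \<epsilon> * c * r * m\<^sup>2\<close> costs at most half of
    \<open>m\<^sup>2 / r ^ 3\<close>; the other half absorbs \<open>\<epsilon> * m\<close> by
    completing the square.\<close>
  define N where "N = 1 + 4 * c\<^sup>2 * K ^ 4"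
  have N: "N \<ge> 1" by (simp add: N_def)
  have "r ^ 4 \<le> K ^ 4" using r by (intro power_mono) auto
  then have "4 * c\<^sup>2 * r ^ 4 \<le> N" by (smt (verit) N_def mult_left_mono zero_le_power2)
  then have "4 * (c\<^sup>2 / N) * r ^ 4 \<le> 1" using N by (simp add: field_simps)
  then have e1: "4 * (\<epsilon> * c) * r ^ 4 \<le> 1" using \<epsilon> by (simp add: N_def power2_eq_square)
  have "m\<^sup>2 / r ^ 3 - 2 * (\<epsilon> * c) * r * m\<^sup>2 = (m\<^sup>2 / (2 * r ^ 3)) * (2 - 4 * (\<epsilon> * c) * r ^ 4)"
    using r by (simp add: field_simps power_eq_if)
  also have "\<dots> \<ge> (m\<^sup>2 / (2 * r ^ 3)) * 1"
    using e1 r by (intro mult_left_mono) auto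
  finally have 1: "m\<^sup>2 / r ^ 3 - 2 * (\<epsilon> * c) * r * m\<^sup>2 \<ge> m\<^sup>2 / (2 * r ^ 3)" by simp
  have "m\<^sup>2 / (2 * r ^ 3) + \<epsilon> * m + \<epsilon>\<^sup>2 * r ^ 3 / 2 = (m + \<epsilon> * r ^ 3)\<^sup>2 / (2 * r ^ 3)"
    using r by (simp add: field_simps power2_eq_square power_eq_if)
  also have "\<dots> \<ge> 0" using r by simp
  finally have 2: "m\<^sup>2 / (2 * r ^ 3) + \<epsilon> * m \<ge> - (\<epsilon>\<^sup>2 * r ^ 3 / 2)" by simp
  \<comment> \<open>Completing the square costs \<open>\<epsilon>\<^sup>2 * r ^ 3 / 2\<close>, less
    than the gain \<open>\<epsilon> * c * r ^ 3\<close>, since \<epsilon> = c / N with N \<ge>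
    1.\<close>
  have ec: "\<epsilon> * c - \<epsilon>\<^sup>2 / 2 > 0"
  proof -
    have eN: "\<epsilon> = c / N" by (simp add: \<epsilon> N_def)
    have "\<epsilon> * c - \<epsilon>\<^sup>2 / 2 = (c\<^sup>2 / N) * (1 - 1 / (2 * N))"
      unfolding eN using N by (simp add: field_simps power2_eq_square)
    moreover have "1 / (2 * N) < 1" using N by simp
    ultimately show ?thesis using N \<open>c \<noteq> 0\<close> by simp
  qed
  then have "(\<epsilon> * c - \<epsilon>\<^sup>2 / 2) * r ^ 3 > 0" using r by simp
  then show ?thesis using 1 2 by (simp add: algebra_simps)
qed

locale surface_with_curvature =
  fixes M :: "(real^3) set" and \<nu> :: "real^3 \<Rightarrow> real^3" and c :: real
  assumes smooth: "smooth_surface M" and nonempty: "M \<noteq> {}" and connected: "connected M"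
    and compact: "compact M" and outward: "outward_unit_normal M \<nu>"
    and char_axis: "characteristic M p \<Longrightarrow> rad p = 0" and c_nonzero: "c \<noteq> 0"
    and curvature: "\<lbrakk>p \<in> M; \<not> characteristic M p\<rbrakk> \<Longrightarrow> horizontal_mean_curvature M \<nu> p = c * rad p"
begin

definition a where "a p = horizontal_normal \<nu> p $ 1"
definition b where "b p = horizontal_normal \<nu> p $ 2"
text \<open>Along a leaf, i.e. a curve in \<open>M\<close> with velocity \<open>- \<eta>\<close>, whose projection has velocity \<open>(- b, a)\<close>,
  one has \<open>r r' = h\<close> and \<open>t' = 2 m\<close>.\<close>

definition m where "m p = p$1 * a p + p$2 * b p"
definition h where "h p = p$2 * a p - p$1 * b p"

lemma m_h_squares: "(m p)\<^sup>2 + (h p)\<^sup>2 = (rad p)\<^sup>2 * ((a p)\<^sup>2 + (b p)\<^sup>2)"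
  unfolding rad_sq m_def h_def by (simp add: power2_eq_square algebra_simps)

lemma m_h_squares_le: "(m p)\<^sup>2 + (h p)\<^sup>2 \<le> (rad p)\<^sup>2"
  unfolding m_h_squares a_def b_def
  using mult_left_mono[OF horizontal_normal_norm_le, of "(rad p)\<^sup>2" \<nu> p] by simp

lemma abs_m_le: "\<bar>m p\<bar> \<le> rad p" and abs_h_le: "\<bar>h p\<bar> \<le> rad p"
proof -
  have "(m p)\<^sup>2 \<le> (rad p)\<^sup>2" "(h p)\<^sup>2 \<le> (rad p)\<^sup>2"
    using m_h_squares_le[of p] by (smt (verit) zero_le_power2)+
  then show "\<bar>m p\<bar> \<le> rad p" "\<bar>h p\<bar> \<le> rad p"
    using rad_nonneg[of p] by (simp_all add: abs_le_square_iff[symmetric])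
qed

lemma m_h_squares_eq:
  assumes "p \<in> M" "\<not> characteristic M p"
  shows "(m p)\<^sup>2 + (h p)\<^sup>2 = (rad p)\<^sup>2"
  using m_h_squares horizontal_normal_regular(2)[OF smooth outward assms] by (simp add: a_def b_def)

lemma off_axis: "rad p > 0 \<Longrightarrow> \<not> characteristic M p"
  using char_axis by force

lemma continuous_m_h:
  assumes "p \<in> M" "\<not> characteristic M p"
  shows "continuous (at p within M) m" "continuous (at p within M) h"
proof -
  have *: "continuous (at p within M) (horizontal_normal \<nu>)"
    using horizontal_normal_regular(1)[OF smooth outward assms] by (rule differentiable_imp_continuous_within)
  have ab: "continuous (at p within M) a" "continuous (at p within M) b"
    unfolding a_def[abs_def] b_def[abs_def] by (intro continuous_intros *)+
  show "continuous (at p within M) m" "continuous (at p within M) h"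
    unfolding m_def[abs_def] h_def[abs_def] by (intro continuous_intros ab)+
qed

text \<open>The product rule, with (x, y) moving at velocity (-b, a) and (a, b) turning at rate c r.
  The derivative of \<open>rad\<close> is stated only off the axis, where the square root of its
  square is differentiable.\<close>

lemma leaf:
  assumes p: "p \<in> M" "\<not> characteristic M p"
  obtains \<gamma> where "\<gamma> (0::real) = p" "\<And>s. \<gamma> s \<in> M"
    "((\<lambda>s. \<gamma> s $ 3) has_real_derivative 2 * m p) (at 0)"
    "((\<lambda>s. m (\<gamma> s)) has_real_derivative c * rad p * h p) (at 0)"
    "((\<lambda>s. h (\<gamma> s)) has_real_derivative 1 - c * rad p * m p) (at 0)"
    "((\<lambda>s. (rad (\<gamma> s))\<^sup>2) has_real_derivative 2 * h p) (at 0)"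
    "rad p > 0 \<Longrightarrow> ((\<lambda>s. rad (\<gamma> s)) has_real_derivative h p / rad p) (at 0)"
proof -
  obtain \<gamma> where \<gamma>: "\<gamma> (0::real) = p" "\<And>s. \<gamma> s \<in> M"
    "((\<lambda>s. \<gamma> s $ 1) has_real_derivative - b p) (at 0)"
    "((\<lambda>s. \<gamma> s $ 2) has_real_derivative a p) (at 0)"
    "((\<lambda>s. \<gamma> s $ 3) has_real_derivative 2 * (p$1 * a p + p$2 * b p)) (at 0)"
    "((\<lambda>s. a (\<gamma> s)) has_real_derivative - b p * (c * rad p)) (at 0)"
    "((\<lambda>s. b (\<gamma> s)) has_real_derivative a p * (c * rad p)) (at 0)"
    by (rule leaf_curve[OF smooth outward p, unfolded curvature[OF p], folded a_def b_def]) (rule that)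
  have one: "a p * a p + b p * b p = 1"
    using horizontal_normal_regular(2)[OF smooth outward p] by (simp add: a_def b_def power2_eq_square)
  have r2: "((\<lambda>s. (rad (\<gamma> s))\<^sup>2) has_real_derivative 2 * h p) (at 0)"
    unfolding rad_sq h_def
    by (auto intro!: derivative_eq_intros \<gamma>(3,4) simp: \<gamma>(1) algebra_simps)
  show thesis
  proof
    show "\<gamma> 0 = p" "\<gamma> s \<in> M" for s by fact+
    show "((\<lambda>s. \<gamma> s $ 3) has_real_derivative 2 * m p) (at 0)" using \<gamma>(5) by (simp add: m_def)
    show "((\<lambda>s. m (\<gamma> s)) has_real_derivative c * rad p * h p) (at 0)"
      unfolding m_def h_def
      by (auto intro!: derivative_eq_intros \<gamma>(3-7) simp: \<gamma>(1) algebra_simps)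
    have "((\<lambda>s. h (\<gamma> s)) has_real_derivative
       a p * a p + b p * b p - c * rad p * m p) (at 0)"
      unfolding m_def h_def
      by (auto intro!: derivative_eq_intros \<gamma>(3-7) simp: \<gamma>(1) algebra_simps)
    then show "((\<lambda>s. h (\<gamma> s)) has_real_derivative 1 - c * rad p * m p) (at 0)" using one by simp
    show "((\<lambda>s. (rad (\<gamma> s))\<^sup>2) has_real_derivative 2 * h p) (at 0)" by fact
    assume r: "rad p > 0"
    have "rad q = sqrt ((rad q)\<^sup>2)" for q using rad_nonneg[of q] by (rule real_sqrt_unique[OF refl, symmetric])
    then have eq: "(\<lambda>s. rad (\<gamma> s)) = (\<lambda>s. sqrt ((rad (\<gamma> s))\<^sup>2))" by blast
    have pos: "0 < (rad (\<gamma> 0))\<^sup>2" using r \<gamma>(1) by simp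
    have "((\<lambda>s. sqrt ((rad (\<gamma> s))\<^sup>2)) has_real_derivative inverse (sqrt ((rad (\<gamma> 0))\<^sup>2)) / 2 * (2 * h p)) (at 0)"
      by (rule DERIV_chain2[OF DERIV_real_sqrt[OF pos] r2])
    moreover have "inverse (sqrt ((rad (\<gamma> 0))\<^sup>2)) / 2 * (2 * h p) = h p / rad p"
      using r by (simp add: \<gamma>(1) field_simps)
    ultimately have "((\<lambda>s. sqrt ((rad (\<gamma> s))\<^sup>2)) has_real_derivative h p / rad p) (at 0)"
      by (rule DERIV_cong)
    then show "((\<lambda>s. rad (\<gamma> s)) has_real_derivative h p / rad p) (at 0)"
      by (rule ssubst[OF eq])
  qed
qed

text \<open>The maximum argument with weight \<open>exp G\<close>. Off the axis \<open>A\<close> is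
  stationary along the leaf and \<open>G\<close> increases strictly, so \<open>\<Psi>\<close> can be
  stationary only where \<open>A = 0\<close>; on the axis \<open>A = 0\<close> since |m| \<le>
  r.\<close>

lemma m_eq:
  assumes "p \<in> M"
  shows "m p = c * rad p ^ 3 / 3"
proof -
  obtain K where K: "\<And>x. x \<in> M \<Longrightarrow> norm x \<le> K" using compact_imp_bounded[OF compact] by (auto simp: bounded_iff)
  have radK: "rad x \<le> K" if "x \<in> M" for x using K[OF that] rad_le_norm[of x] by linarith
  define \<epsilon> where "\<epsilon> = c / (1 + 4 * c\<^sup>2 * K ^ 4)"
  define G where "G q = c * q$3 / 2 + h q / rad q + \<epsilon> * (h q * m q)" for q
  define A where "A q = m q - c * rad q ^ 3 / 3" for q
  define \<Psi> where "\<Psi> q = (A q)\<^sup>2 * exp (G q)" for q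
  define B where "B = \<bar>c\<bar> * K / 2 + 1 + \<bar>\<epsilon>\<bar> * K\<^sup>2"
  have GB: "G q \<le> B" if "q \<in> M" for q
  proof -
    have "\<bar>q$3\<bar> \<le> K" using K[OF that] component_le_norm_cart[of q 3] by linarith
    then have "\<bar>c * q$3 / 2\<bar> \<le> \<bar>c\<bar> * K / 2" by (simp add: abs_mult mult_left_mono)
    moreover have "\<bar>h q / rad q\<bar> \<le> 1"
      using abs_h_le[of q] rad_nonneg[of q] by (auto simp: abs_divide divide_le_eq_1)
    moreover have "\<bar>\<epsilon> * (h q * m q)\<bar> \<le> \<bar>\<epsilon>\<bar> * K\<^sup>2"
      using abs_h_le[of q] abs_m_le[of q] radK[OF that]
      unfolding abs_mult power2_eq_square by (intro mult_mono) (auto simp: abs_mult)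
    ultimately show ?thesis unfolding G_def B_def by linarith
  qed
  have "continuous (at q within M) \<Psi>" if q: "q \<in> M" for q
  proof (cases "rad q = 0")
    case False
    then have nc: "\<not> characteristic M q" using off_axis rad_nonneg[of q] by auto
    have "continuous (at q within M) rad"
      using continuous_rad q by (metis continuous_on_eq_continuous_within)
    then show ?thesis
      unfolding \<Psi>_def[abs_def] G_def A_def using False
      by (intro continuous_intros continuous_m_h[OF q nc]) auto
  next
    case True
    \<comment> \<open>\<open>G\<close> need not be continuous on the axis, but \<open>exp G\<close>
      is bounded on \<open>M\<close> and \<open>A\<close> tends to 0 there, so \<open>\<Psi>\<close>
      tends to 0.\<close>
    have "\<bar>A x\<bar> \<le> rad x + \<bar>c\<bar> * rad x ^ 3 / 3" for x
      using abs_m_le[of x] rad_nonneg[of x] abs_triangle_ineq4[of "m x" "c * rad x ^ 3 / 3"]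
      by (simp add: A_def abs_mult)
    then have A2: "(A x)\<^sup>2 \<le> (rad x + \<bar>c\<bar> * rad x ^ 3 / 3)\<^sup>2" for x
      by (metis abs_ge_zero power2_abs power_mono)
    have le: "norm (\<Psi> x) \<le> (rad x + \<bar>c\<bar> * rad x ^ 3 / 3)\<^sup>2 * exp B" if "x \<in> M" for x
      unfolding \<Psi>_def using A2 GB[OF that] by (auto simp: abs_mult intro!: mult_mono)
    have "(rad \<longlongrightarrow> rad q) (at q within M)"
      using continuous_rad q by (simp add: continuous_on_def)
    then have "((\<lambda>x. (rad x + \<bar>c\<bar> * rad x ^ 3 / 3)\<^sup>2 * exp B) \<longlongrightarrow> (rad q + \<bar>c\<bar> * rad q ^ 3 / 3)\<^sup>2 * exp B) (at q within M)"
      by (intro tendsto_intros) simp_all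
    then have lim: "((\<lambda>x. (rad x + \<bar>c\<bar> * rad x ^ 3 / 3)\<^sup>2 * exp B) \<longlongrightarrow> 0) (at q within M)"
      using True by simp
    have "(\<Psi> \<longlongrightarrow> 0) (at q within M)"
      by (rule Lim_null_comparison[OF _ lim]) (use le in \<open>auto simp: eventually_at_filter\<close>)
    moreover have "\<Psi> q = 0" using abs_m_le[of q] True by (simp add: \<Psi>_def A_def)
    ultimately show ?thesis by (simp add: continuous_within)
  qed
  then have "continuous_on M \<Psi>" by (simp add: continuous_on_eq_continuous_within)
  then obtain z where z: "z \<in> M" "\<And>y. y \<in> M \<Longrightarrow> \<Psi> y \<le> \<Psi> z"
    using continuous_attains_sup[OF compact nonempty] by blast
  have "\<Psi> z = 0"
  proof (cases "rad z = 0")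
    case True
    then show ?thesis using abs_m_le[of z] by (simp add: \<Psi>_def A_def)
  next
    case False
    then have r: "rad z > 0" using rad_nonneg[of z] by simp
    obtain \<gamma> where \<gamma>: "\<gamma> (0::real) = z" "\<And>s. \<gamma> s \<in> M"
      "((\<lambda>s. \<gamma> s $ 3) has_real_derivative 2 * m z) (at 0)"
      "((\<lambda>s. m (\<gamma> s)) has_real_derivative c * rad z * h z) (at 0)"
      "((\<lambda>s. h (\<gamma> s)) has_real_derivative 1 - c * rad z * m z) (at 0)"
      "((\<lambda>s. (rad (\<gamma> s))\<^sup>2) has_real_derivative 2 * h z) (at 0)"
      "rad z > 0 \<Longrightarrow> ((\<lambda>s. rad (\<gamma> s)) has_real_derivative h z / rad z) (at 0)"
      by (rule leaf[OF z(1) off_axis[OF r]]) (rule that)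
    note dr = \<gamma>(7)[OF r]
    have h2: "(h z)\<^sup>2 = (rad z)\<^sup>2 - (m z)\<^sup>2" using m_h_squares_eq[OF z(1) off_axis[OF r]] by simp
    have dA: "((\<lambda>s. A (\<gamma> s)) has_real_derivative 0) (at 0)"
      unfolding A_def
      by (auto intro!: derivative_eq_intros \<gamma>(4) dr simp: \<gamma>(1)) (use r in \<open>simp add: field_simps power2_eq_square\<close>)
    define g where "g = c * m z + ((1 - c * rad z * m z) * rad z - h z * (h z / rad z)) / (rad z * rad z)
       + \<epsilon> * ((1 - c * rad z * m z) * m z + c * rad z * h z * h z)"
    have dG: "((\<lambda>s. G (\<gamma> s)) has_real_derivative g) (at 0)"
    proof -
      have 1: "((\<lambda>s. h (\<gamma> s) / rad (\<gamma> s)) has_real_derivative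
          ((1 - c * rad z * m z) * rad z - h z * (h z / rad z)) / (rad z * rad z)) (at 0)"
        using DERIV_divide[OF \<gamma>(5) dr] r by (simp add: \<gamma>(1))
      have 2: "((\<lambda>s. h (\<gamma> s) * m (\<gamma> s)) has_real_derivative
          (1 - c * rad z * m z) * m z + c * rad z * h z * h z) (at 0)"
        using DERIV_mult[OF \<gamma>(5,4)] by (simp add: \<gamma>(1))
      have 3: "((\<lambda>s. c * \<gamma> s $ 3 / 2) has_real_derivative c * m z) (at 0)"
        using DERIV_cmult[OF \<gamma>(3), of "c / 2"] by simp
      show ?thesis
        unfolding G_def g_def by (intro DERIV_add DERIV_cmult 1 2 3)
    qed
    have d\<Psi>: "((\<lambda>s. \<Psi> (\<gamma> s)) has_real_derivative (A z)\<^sup>2 * (exp (G z) * g)) (at 0)"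
      unfolding \<Psi>_def
      by (rule derivative_eq_intros dA dG refl)+ (simp add: \<gamma>(1) algebra_simps)
    have "g = c * m z + ((1 - c * rad z * m z) * rad z - (h z)\<^sup>2 / rad z) / (rad z * rad z)
       + \<epsilon> * ((1 - c * rad z * m z) * m z + c * rad z * (h z)\<^sup>2)"
      by (simp add: g_def power2_eq_square)
    also have "\<dots> = (m z)\<^sup>2 / rad z ^ 3 + \<epsilon> * (m z + c * rad z ^ 3 - 2 * c * rad z * (m z)\<^sup>2)"
      unfolding h2 using r by (simp add: field_simps power2_eq_square power3_eq_cube)
    also have "\<dots> > 0" by (rule leaf_derivative_pos[OF r radK[OF z(1)] c_nonzero \<epsilon>_def])
    finally have g: "g > 0" .
    have "(A z)\<^sup>2 * (exp (G z) * g) = 0"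
      by (rule max_along_curve_derivative[where \<Psi>=\<Psi>, OF z(2) \<gamma>(1,2) d\<Psi>])
    then show ?thesis using g by (simp add: \<Psi>_def)
  qed
  moreover have "\<Psi> p \<ge> 0" by (simp add: \<Psi>_def)
  ultimately have "\<Psi> p = 0" using z(2)[OF assms] by linarith
  then show ?thesis by (simp add: \<Psi>_def A_def)
qed

end

section \<open>Points of maximal radius\<close>

lemma inner_real3: "(g::real^3) \<bullet> v = g$1 * v$1 + g$2 * v$2 + g$3 * v$3"
  by (simp add: inner_vec_def sum_3)

lemma convex_cylinder: "convex {q. rad q \<le> r}"
proof -
  have "{q. rad q \<le> r} = (\<lambda>q. (q$1, q$2)) -` cball 0 r"
    by (auto simp: rad_def norm_Pair)
  moreover have "linear (\<lambda>q::real^3. (q$1, q$2))" by (simp add: linear_iff)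
  ultimately show ?thesis using convex_linear_vimage[OF _ convex_cball] by simp
qed

context surface_with_curvature
begin

lemma surface_local:
  assumes "p \<in> M" "open W" "p \<in> W"
  obtains U f G where "open U" "p \<in> U" "U \<subseteq> W"
    "\<And>x. x \<in> U \<Longrightarrow> (f has_derivative (\<lambda>h. G x \<bullet> h)) (at x)"
    "\<And>x. x \<in> U \<Longrightarrow> G differentiable (at x)" "\<And>x. x \<in> U \<Longrightarrow> G x \<noteq> 0"
    "M \<inter> U = {x \<in> U. f x = 0}" "connected (M \<inter> U - {p})" "p islimpt M"
    "\<And>x. x \<in> M \<inter> U \<Longrightarrow> tangent_space M x = {v. G x \<bullet> v = 0}"
    "\<And>x. x \<in> M \<inter> U \<Longrightarrow> \<nu> x = heis_normal (G x) x"
  by (rule outward_surface_local[OF smooth outward assms]) (rule that)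

lemma surface_gradient:
  assumes "p \<in> M"
  obtains g where "g \<noteq> 0" "tangent_space M p = {v. g \<bullet> v = 0}" "\<nu> p = heis_normal g p"
proof -
  obtain U f G where U: "open U" "p \<in> U" "U \<subseteq> UNIV"
    "\<And>x. x \<in> U \<Longrightarrow> (f has_derivative (\<lambda>h. G x \<bullet> h)) (at x)"
    "\<And>x. x \<in> U \<Longrightarrow> G differentiable (at x)" "\<And>x. x \<in> U \<Longrightarrow> G x \<noteq> 0"
    "M \<inter> U = {x \<in> U. f x = 0}" "connected (M \<inter> U - {p})" "p islimpt M"
    "\<And>x. x \<in> M \<inter> U \<Longrightarrow> tangent_space M x = {v. G x \<bullet> v = 0}"
    "\<And>x. x \<in> M \<inter> U \<Longrightarrow> \<nu> x = heis_normal (G x) x"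
    by (rule surface_local[OF assms open_UNIV UNIV_I]) (rule that)
  have p: "p \<in> M \<inter> U" using assms U(2) by simp
  show thesis using that[OF U(6)[OF U(2)] U(10)[OF p] U(11)[OF p]] .
qed

text \<open>If \<open>M\<close> lay in the axis, every tangent vector would be vertical, but the
  kernel of \<open>g\<close> is two-dimensional.\<close>

lemma exists_off_axis: "\<exists>p\<in>M. rad p > 0"
proof (rule ccontr)
  assume "\<not> ?thesis"
  then have r0: "rad p = 0" if "p \<in> M" for p using that rad_nonneg[of p] by force
  obtain p where p: "p \<in> M" using nonempty by blast
  obtain g where g: "g \<noteq> 0" "tangent_space M p = {v. g \<bullet> v = 0}" "\<nu> p = heis_normal g p"
    by (rule surface_gradient[OF p]) (rule that)
  have z: "v$1 = 0 \<and> v$2 = 0" if v: "g \<bullet> v = 0" for v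
  proof -
    have "v \<in> tangent_space M p" using g v by simp
    then obtain \<gamma> where \<gamma>: "\<gamma> (0::real) = p" "\<And>s. \<gamma> s \<in> M" "\<And>i. ((\<lambda>s. \<gamma> s $ i) has_real_derivative v $ i) (at 0)"
      by (rule tangent_curve[OF _ p]) (rule that)
    have "\<gamma> s $ 1 = 0" "\<gamma> s $ 2 = 0" for s using r0[OF \<gamma>(2)] by (simp_all add: rad_eq_0_iff)
    then have "((\<lambda>s::real. 0) has_real_derivative v $ 1) (at 0)" "((\<lambda>s::real. 0) has_real_derivative v $ 2) (at 0)"
      using \<gamma>(3)[of 1] \<gamma>(3)[of 2] by simp_all
    then show ?thesis using DERIV_unique[OF _ DERIV_const] by blast
  qed
  have "g$3 = 0" using z[of "vector [g$3, 0, - g$1]"] by (simp add: inner_real3 vector_3)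
  moreover have "g$1 = 0" "g$2 = 0" using z[of "vector [g$2, - g$1, 0]"] by (simp_all add: inner_real3 vector_3)
  ultimately show False using g(1) by (simp add: vec_eq_iff forall_3)
qed

text \<open>The squared radius is stationary along \<open>M\<close> at \<open>p\<close>, so the
  conormal is radial without vertical part, h = 0, and m = r or m = -r. The second sign is
  impossible: moving against the normal would then leave the convex cylinder of radius
  \<open>rad p\<close>, which contains \<open>M\<close>, and so lead outside
  \<open>M\<close>.\<close>

lemma m_at_max_radius:
  assumes p: "p \<in> M" and max: "\<And>q. q \<in> M \<Longrightarrow> rad q \<le> rad p" and r: "rad p > 0"
  shows "m p = rad p"
proof -
  obtain g where g: "g \<noteq> 0" "tangent_space M p = {v. g \<bullet> v = 0}" "\<nu> p = heis_normal g p"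
    by (rule surface_gradient[OF p]) (rule that)
  have z: "p$1 * v$1 + p$2 * v$2 = 0" if v: "g \<bullet> v = 0" for v
  proof -
    have "v \<in> tangent_space M p" using g v by simp
    then obtain \<gamma> where \<gamma>: "\<gamma> (0::real) = p" "\<And>s. \<gamma> s \<in> M" "\<And>i. ((\<lambda>s. \<gamma> s $ i) has_real_derivative v $ i) (at 0)"
      by (rule tangent_curve[OF _ p]) (rule that)
    have "((\<lambda>s. (rad (\<gamma> s))\<^sup>2) has_real_derivative 2 * (p$1 * v$1 + p$2 * v$2)) (at 0)"
      unfolding rad_sq by (auto intro!: derivative_eq_intros \<gamma>(3) simp: \<gamma>(1))
    then have "2 * (p$1 * v$1 + p$2 * v$2) = 0"
      by (rule max_along_curve_derivative[where \<Psi>="\<lambda>q. (rad q)\<^sup>2" and p=p and M=M, rotated 3])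
        (use max \<gamma>(1,2) in \<open>auto simp: power_mono rad_nonneg\<close>)
    then show ?thesis by simp
  qed
  have "p$1 * g$3 = 0" "p$2 * g$3 = 0"
    using z[of "vector [g$3, 0, - g$1]"] z[of "vector [0, g$3, - g$2]"] by (simp_all add: inner_real3 vector_3)
  then have g3: "g$3 = 0" using r rad_eq_0_iff[of p] by auto
  have xy: "p$1 * g$2 = p$2 * g$1" using z[of "vector [g$2, - g$1, 0]"] by (simp add: inner_real3 vector_3)
  have ab: "a p = g$1 / sqrt ((g$1)\<^sup>2 + (g$2)\<^sup>2)" "b p = g$2 / sqrt ((g$1)\<^sup>2 + (g$2)\<^sup>2)"
    unfolding a_def b_def horizontal_normal_of_heis_normal[of \<nu> p g, OF g(3) g(1)]
    by (simp_all add: inner_heis_frame g3 heis_frame_components)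
  have "h p = 0" unfolding h_def ab using xy by (simp add: mult.commute flip: diff_divide_distrib)
  then have m2: "(m p)\<^sup>2 = (rad p)\<^sup>2" using m_h_squares_eq[OF p off_axis[OF r]] by simp
  show ?thesis
  proof (rule ccontr)
    assume "m p \<noteq> rad p"
    then have m: "m p = - rad p" using m2 by (metis power2_eq_iff)
    define n where "n = sqrt ((\<nu> p $ 1)\<^sup>2 + (\<nu> p $ 2)\<^sup>2)"
    have abn: "a p = \<nu> p $ 1 / n" "b p = \<nu> p $ 2 / n"
      by (simp_all add: a_def b_def horizontal_normal_frame n_def heis_frame_components)
    have one: "(a p)\<^sup>2 + (b p)\<^sup>2 = 1"
      using horizontal_normal_regular(2)[OF smooth outward p off_axis[OF r]] by (simp add: a_def b_def)
    then have "n \<noteq> 0" using abn by auto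
    then have n: "n > 0" unfolding n_def by (metis less_eq_real_def real_sqrt_ge_zero sum_power2_ge_zero)
    have \<nu>: "\<nu> p $ 1 = n * a p" "\<nu> p $ 2 = n * b p" using abn n by simp_all
    have out: "p - s *\<^sub>R \<nu> p \<in> outside M" if s: "s > 0" for s
    proof -
      have "(rad (p - s *\<^sub>R \<nu> p))\<^sup>2 = (rad p)\<^sup>2 - 2 * (s * n) * m p + (s * n)\<^sup>2 * ((a p)\<^sup>2 + (b p)\<^sup>2)"
        unfolding rad_sq m_def by (simp add: \<nu> power2_eq_square algebra_simps)
      also have "\<dots> > (rad p)\<^sup>2" using m one s n r by (simp add: add_pos_pos)
      finally have "rad (p - s *\<^sub>R \<nu> p) > rad p" using rad_nonneg power2_less_imp_less by blast
      moreover have "- {q. rad q \<le> rad p} \<subseteq> outside M"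
        by (rule outside_subset_convex[OF convex_cylinder]) (use max in auto)
      ultimately show ?thesis by auto
    qed
    have "\<forall>\<^sub>F s in at_right (0::real). p - s *\<^sub>R \<nu> p \<in> inside M"
      using outward p unfolding outward_unit_normal_def by (auto elim: eventually_mono)
    moreover have "\<forall>\<^sub>F s in at_right (0::real). s > 0" by (simp add: eventually_at_right_less)
    ultimately have "\<forall>\<^sub>F s in at_right (0::real). False"
      by eventually_elim (use out inside_Int_outside in blast)
    then show False by simp
  qed
qed

lemma c_pos: "c > 0"
proof -
  obtain p where p: "p \<in> M" "\<And>q. q \<in> M \<Longrightarrow> rad q \<le> rad p"
    using continuous_attains_sup[OF compact nonempty continuous_rad] by blast
  have r: "rad p > 0" using exists_off_axis p(2) by (meson less_le_trans)
  have "rad p = c * rad p ^ 3 / 3" using m_at_max_radius[OF p r] m_eq[OF p(1)] by simp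
  then have "rad p * (c * (rad p)\<^sup>2) = rad p * 3" by (simp add: power2_eq_square power3_eq_cube)
  then have "0 < c * (rad p)\<^sup>2" using r by simp
  then show ?thesis using r by (simp add: zero_less_mult_iff)
qed

definition R where "R = sqrt (3 / c)"

lemma R_pos: "R > 0" and c_R: "c * R\<^sup>2 = 3"
  using c_pos by (simp_all add: R_def)

lemma m_R:
  assumes "p \<in> M"
  shows "m p = rad p ^ 3 / R\<^sup>2"
proof -
  have "m p * R\<^sup>2 = (c * R\<^sup>2) * rad p ^ 3 / 3" using m_eq[OF assms] by simp
  then show ?thesis using R_pos unfolding c_R by (simp add: field_simps)
qed

text \<open>Beyond radius \<open>R\<close> the value r^3 / R^2 of \<open>m\<close> would exceed r,
  against |m| \<le> r.\<close>

lemma rad_le_R: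
  assumes "p \<in> M"
  shows "rad p \<le> R"
proof (rule ccontr)
  assume *: "\<not> rad p \<le> R"
  then have "R\<^sup>2 < (rad p)\<^sup>2" using R_pos by (intro power_strict_mono) auto
  then have "R\<^sup>2 * rad p < (rad p)\<^sup>2 * rad p" using * R_pos by (intro mult_strict_right_mono) auto
  then have "rad p < rad p ^ 3 / R\<^sup>2" using R_pos by (simp add: field_simps power2_eq_square power3_eq_cube)
  then show False using m_R[OF assms] abs_m_le[of p] by linarith
qed

lemma h_squared:
  assumes "p \<in> M"
  shows "(h p)\<^sup>2 = (rad p)\<^sup>2 - rad p ^ 6 / R ^ 4"
proof (cases "rad p = 0")
  case True
  then show ?thesis using abs_h_le[of p] by simp
next
  case False
  then have "rad p > 0" using rad_nonneg[of p] by simp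
  then show ?thesis
    using m_h_squares_eq[OF assms off_axis] m_R[OF assms] by (simp add: power_divide flip: power_mult)
qed

end

section \<open>The second integral\<close>

text \<open>A one-sided form of Fermat's criterion: where a leaf crosses the axis, the branch of
  \<open>center\<close> is controlled only for s > 0.\<close>

lemma right_max_derivative:
  fixes F :: "real \<Rightarrow> real"
  assumes "(F has_real_derivative d) (at 0)" "\<forall>\<^sub>F s in at_right 0. F s \<le> F 0"
  shows "d \<le> 0"
proof (rule ccontr)
  assume "\<not> d \<le> 0"
  then obtain e where e: "e > 0" "\<And>s. 0 < s \<Longrightarrow> s < e \<Longrightarrow> F 0 < F s"
    using has_real_derivative_pos_inc_right[OF assms(1)] by force
  have "\<forall>\<^sub>F s in at_right (0::real). 0 < s \<and> s < e"
    using e by (auto simp: eventually_at_right intro!: exI[of _ e])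
  with assms(2) have "\<forall>\<^sub>F s in at_right (0::real). False"
    by eventually_elim (use e(2) in force)
  then show False by simp
qed

text \<open>Vanishes when a gauge sphere of radius \<open>R\<close> centered at height \<open>\<tau>\<close> has a pole at a height in \<open>T\<close>. It has
  period \<open>2 R\<^sup>2\<close>, the height of that sphere, because a leaf that crosses the axis passes from one
  sphere to the next.\<close>

definition height_test :: "real \<Rightarrow> real set \<Rightarrow> real \<Rightarrow> real" where
  "height_test R T \<tau> = (\<Prod>t\<in>T. (cos (pi * (\<tau> - t) / (2 * R\<^sup>2)))\<^sup>2)"

lemma height_test_nonneg: "height_test R T \<tau> \<ge> 0"
  by (simp add: height_test_def prod_nonneg)

lemma height_test_periodic:
  assumes "R > 0"
  shows "height_test R T (\<tau> + R\<^sup>2) = height_test R T (\<tau> - R\<^sup>2)"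
  unfolding height_test_def
proof (rule prod.cong[OF refl])
  fix t
  have "pi * (\<tau> + R\<^sup>2 - t) / (2 * R\<^sup>2) = pi * (\<tau> - R\<^sup>2 - t) / (2 * R\<^sup>2) + pi"
    using assms by (simp add: field_simps)
  then show "(cos (pi * (\<tau> + R\<^sup>2 - t) / (2 * R\<^sup>2)))\<^sup>2 = (cos (pi * (\<tau> - R\<^sup>2 - t) / (2 * R\<^sup>2)))\<^sup>2"
    by simp
qed

lemma height_test_pole:
  assumes "R > 0" "finite T" "t \<in> T"
  shows "height_test R T (t + R\<^sup>2) = 0"
proof -
  have "cos (pi * (t + R\<^sup>2 - t) / (2 * R\<^sup>2)) = cos (pi / 2)" using assms(1) by simp
  then show ?thesis unfolding height_test_def using assms by (intro prod_zero) (auto intro!: bexI[of _ t])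
qed

lemma height_test_DERIV:
  assumes "finite T"
  shows "\<exists>d. (height_test R T has_real_derivative d) (at \<tau>)"
  using assms unfolding height_test_def[abs_def]
proof (induction T)
  case empty
  show ?case by (auto intro!: exI[of _ 0])
next
  case (insert t T)
  then obtain d where d: "((\<lambda>\<tau>. \<Prod>t\<in>T. (cos (pi * (\<tau> - t) / (2 * R\<^sup>2)))\<^sup>2) has_real_derivative d) (at \<tau>)" by blast
  have "((\<lambda>\<tau>. (cos (k * (\<tau> - t)))\<^sup>2) has_real_derivative
     2 * cos (k * (\<tau> - t)) * (- sin (k * (\<tau> - t)) * k)) (at \<tau>)" for k
    by (auto intro!: derivative_eq_intros)
  from this[of "pi / (2 * R\<^sup>2)"] have "((\<lambda>\<tau>. (cos (pi * (\<tau> - t) / (2 * R\<^sup>2)))\<^sup>2) has_real_derivative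
     2 * cos (pi * (\<tau> - t) / (2 * R\<^sup>2)) * (- sin (pi * (\<tau> - t) / (2 * R\<^sup>2)) * (pi / (2 * R\<^sup>2)))) (at \<tau>)"
    by simp
  from DERIV_mult[OF this d] show ?case using insert.hyps by auto
qed

text \<open>Zeros sit at odd multiples of R^2 from the heights in \<open>T\<close>; boundedness of
  \<open>M\<close> will leave finitely many of them.\<close>

lemma height_test_zeroD:
  assumes "R > 0" "finite T" "height_test R T \<tau> = 0"
  obtains t i where "t \<in> T" "odd i" "\<tau> = t + of_int i * R\<^sup>2"
proof -
  obtain t where t: "t \<in> T" "cos (pi * (\<tau> - t) / (2 * R\<^sup>2)) = 0"
    using assms(2,3) by (auto simp: height_test_def prod_zero_iff)
  then obtain i where i: "odd i" "pi * (\<tau> - t) / (2 * R\<^sup>2) = of_int i * (pi / 2)"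
    by (auto simp: cos_zero_iff_int)
  then have "pi * ((\<tau> - t) / (2 * R\<^sup>2)) = pi * (of_int i / 2)" by simp
  then have "(\<tau> - t) / (2 * R\<^sup>2) = of_int i / 2" unfolding mult_cancel_left by simp
  then have "\<tau> = t + of_int i * R\<^sup>2" using assms(1) by (simp add: field_simps)
  then show thesis using that t i by blast
qed

section \<open>Characteristic points and leaf centers\<close>

context surface_with_curvature
begin

definition char_points where "char_points = {q. characteristic M q}"

text \<open>All characteristic points lie on the axis and have a vertical gradient. At an
  accumulation point the gradient would be vertical by continuity, while \<open>f\<close> vanishes
  along vertical displacements tending to 0, which forces the vertical derivative to be 0.\<close>

lemma finite_char_points: "finite char_points"
proof (rule ccontr)
  assume "infinite char_points"
  moreover have CM: "char_points \<subseteq> M" by (auto simp: char_points_def characteristic_def)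
  ultimately obtain l where l: "l \<in> M" "l islimpt char_points"
    using compact by (auto simp: compact_eq_Bolzano_Weierstrass)
  obtain U f G where U: "open U" "l \<in> U" "U \<subseteq> UNIV"
    "\<And>x. x \<in> U \<Longrightarrow> (f has_derivative (\<lambda>h. G x \<bullet> h)) (at x)"
    "\<And>x. x \<in> U \<Longrightarrow> G differentiable (at x)" "\<And>x. x \<in> U \<Longrightarrow> G x \<noteq> 0"
    "M \<inter> U = {x \<in> U. f x = 0}" "connected (M \<inter> U - {l})" "l islimpt M"
    "\<And>x. x \<in> M \<inter> U \<Longrightarrow> tangent_space M x = {v. G x \<bullet> v = 0}"
    "\<And>x. x \<in> M \<inter> U \<Longrightarrow> \<nu> x = heis_normal (G x) x"
    by (rule surface_local[OF l(1) open_UNIV UNIV_I]) (rule that)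
  have q0: "q$1 = 0 \<and> q$2 = 0 \<and> G q$1 = 0 \<and> G q$2 = 0" if q: "q \<in> char_points \<inter> U" for q
  proof -
    have qM: "q \<in> M" "characteristic M q" using q CM by (auto simp: char_points_def)
    then have "G q \<bullet> X_field q = 0 \<and> G q \<bullet> Y_field q = 0"
      using characteristic_iff[OF qM(1) U(10) U(6)] q by blast
    then show ?thesis using char_axis[OF qM(2)] by (simp add: rad_eq_0_iff inner_heis_frame)
  qed
  obtain u where u: "\<And>n. u n \<in> char_points - {l}" "u \<longlonglongrightarrow> l"
    using l(2) by (auto simp: islimpt_sequential)
  have evU: "\<forall>\<^sub>F n in sequentially. u n \<in> U" using u(2) U(1,2) by (rule topological_tendstoD)
  have "isCont G l" using U(5)[OF U(2)] by (rule differentiable_imp_continuous_within)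
  then have Gu: "(\<lambda>n. G (u n)) \<longlonglongrightarrow> G l" using u(2) by (rule isCont_tendsto_compose)
  have zero: "(\<lambda>n. k (u n)) \<longlonglongrightarrow> 0" if "\<And>q. q \<in> char_points \<inter> U \<Longrightarrow> k q = 0" for k :: "real^3 \<Rightarrow> real"
  proof (rule tendsto_eventually)
    show "\<forall>\<^sub>F n in sequentially. k (u n) = 0" using evU by eventually_elim (use that u(1) in blast)
  qed
  have l0: "l$1 = 0" "l$2 = 0" "G l$1 = 0" "G l$2 = 0"
    using LIMSEQ_unique[OF tendsto_vec_nth[OF u(2), of 1] zero]
      LIMSEQ_unique[OF tendsto_vec_nth[OF u(2), of 2] zero]
      LIMSEQ_unique[OF tendsto_vec_nth[OF Gu, of 1] zero]
      LIMSEQ_unique[OF tendsto_vec_nth[OF Gu, of 2] zero] q0 by blast+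
  then have g3: "\<bar>G l$3\<bar> / 2 > 0" using U(6)[OF U(2)] by (simp add: vec_eq_iff forall_3)
  obtain d where d: "d > 0" "\<And>y. norm (y - l) < d \<Longrightarrow> norm (f y - f l - G l \<bullet> (y - l)) \<le> \<bar>G l$3\<bar> / 2 * norm (y - l)"
    using U(4)[OF U(2)] g3 unfolding has_derivative_at_alt by blast
  have "\<forall>\<^sub>F n in sequentially. dist (u n) l < d" using u(2) d(1) by (rule tendstoD)
  then have "\<forall>\<^sub>F n in sequentially. False"
    using evU
  proof eventually_elim
    case (elim n)
    have un: "u n \<in> char_points \<inter> U" "u n \<noteq> l" using u(1) elim by auto
    define \<delta> where "\<delta> = u n $ 3 - l $ 3"
    have dl: "u n - l = \<delta> *\<^sub>R axis 3 1"
      using q0[OF un(1)] l0 by (simp add: vec_eq_iff forall_3 axis_def \<delta>_def)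
    have \<delta>: "\<delta> \<noteq> 0" using un(2) dl by auto
    have "f l = 0" "f (u n) = 0" using U(2,7) l(1) un CM by blast+
    moreover have "G l \<bullet> (u n - l) = G l $ 3 * \<delta>" unfolding dl by (simp add: inner_axis)
    moreover have "norm (u n - l) = \<bar>\<delta>\<bar>" unfolding dl by simp
    ultimately have "\<bar>G l$3\<bar> * \<bar>\<delta>\<bar> \<le> \<bar>G l$3\<bar> / 2 * \<bar>\<delta>\<bar>"
      using d(2)[of "u n"] elim by (simp add: dist_norm abs_mult)
    then show False using g3 \<delta> by (simp add: mult_le_0_iff)
  qed
  then show False by simp
qed

text \<open>Height of the center of the gauge sphere of radius \<open>R\<close> containing the leaf through \<open>p\<close>; on the axis, where
  two spheres are possible, the choice is immaterial by periodicity of \<open>height_test\<close>.\<close>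

definition center where "center p = (if rad p = 0 then p$3 + R\<^sup>2 else p$3 + R\<^sup>2 * (h p / rad p))"

text \<open>The vertical distance from the center of a gauge sphere of radius \<open>R\<close>
  centered on the axis to its points at distance \<open>rad p\<close> from the axis.\<close>

definition half_height where "half_height p = sqrt (R ^ 4 - rad p ^ 4)"

lemma half_height_axis: "rad p = 0 \<Longrightarrow> half_height p = R\<^sup>2"
  by (simp add: half_height_def real_sqrt_unique flip: power_mult)

lemma continuous_half_height: "continuous_on S half_height"
  unfolding half_height_def[abs_def] by (intro continuous_intros continuous_rad)

text \<open>Near the axis \<open>half_height\<close> is a differentiable function of the squared
  radius, since the radicand R^4 - r^4 is positive there; its derivative vanishes with that of the
  squared radius.\<close>

lemma half_height_DERIV_axis:
  assumes d: "((\<lambda>s. (rad (\<gamma> s))\<^sup>2) has_real_derivative 0) (at 0)" and "rad (\<gamma> 0) = 0"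
  shows "((\<lambda>s. half_height (\<gamma> s)) has_real_derivative 0) (at 0)"
proof -
  have r4: "((\<lambda>s. R ^ 4 - ((rad (\<gamma> s))\<^sup>2)\<^sup>2) has_real_derivative 0) (at 0)"
    using DERIV_diff[OF DERIV_const DERIV_power[OF d, of 2]] by simp
  have pos: "0 < R ^ 4 - ((rad (\<gamma> 0))\<^sup>2)\<^sup>2" using R_pos assms(2) by simp
  have "((\<lambda>s. sqrt (R ^ 4 - ((rad (\<gamma> s))\<^sup>2)\<^sup>2)) has_real_derivative 0) (at 0)"
    using DERIV_chain2[OF DERIV_real_sqrt[OF pos] r4] by simp
  then show ?thesis by (simp add: half_height_def flip: power_mult)
qed

text \<open>The quantity squared on the left is \<open>center p - p$3\<close>, so this places
  \<open>p\<close> on the gauge sphere of radius \<open>R\<close> about that center.\<close>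

lemma R2_h_squared:
  assumes "p \<in> M" "rad p > 0"
  shows "(R\<^sup>2 * (h p / rad p))\<^sup>2 = R ^ 4 - rad p ^ 4"
proof -
  have "(R\<^sup>2 * (h p / rad p))\<^sup>2 = R ^ 4 * ((rad p)\<^sup>2 - rad p ^ 6 / R ^ 4) / (rad p)\<^sup>2"
    using h_squared[OF assms(1)] by (simp add: power_mult_distrib power_divide flip: power_mult)
  also have "\<dots> = R ^ 4 - rad p ^ 4" using assms(2) R_pos by (simp add: field_simps flip: power_add)
  finally show ?thesis .
qed

lemma center_cases:
  assumes "p \<in> M"
  shows "center p = p$3 + half_height p \<or> center p = p$3 - half_height p"
proof (cases "rad p = 0")
  case True
  then show ?thesis by (simp add: center_def half_height_axis)
next
  case False
  then have "rad p > 0" using rad_nonneg[of p] by simp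
  then have "half_height p = \<bar>R\<^sup>2 * (h p / rad p)\<bar>"
    unfolding half_height_def R2_h_squared[OF assms \<open>rad p > 0\<close>, symmetric] by simp
  then show ?thesis using False by (auto simp: center_def)
qed

lemma center_positive_side:
  assumes "p \<in> M" "h p > 0"
  shows "center p = p$3 + half_height p"
proof -
  have r: "rad p > 0" using abs_h_le[of p] assms(2) by linarith
  then have "half_height p = \<bar>R\<^sup>2 * (h p / rad p)\<bar>"
    unfolding half_height_def R2_h_squared[OF assms(1) r, symmetric] by simp
  then show ?thesis using r assms(2) by (simp add: center_def)
qed

lemma continuous_on_h: "continuous_on M h"
proof (unfold continuous_on_eq_continuous_within, rule ballI)
  fix q assume q: "q \<in> M"
  show "continuous (at q within M) h"
  proof (cases "rad q = 0")
    case False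
    then show ?thesis using continuous_m_h(2)[OF q] off_axis rad_nonneg[of q] by fastforce
  next
    case True
    have "(rad \<longlongrightarrow> rad q) (at q within M)"
      using continuous_rad q by (simp add: continuous_on_def)
    then have lim: "(rad \<longlongrightarrow> 0) (at q within M)" unfolding True .
    have "(h \<longlongrightarrow> 0) (at q within M)"
      by (rule Lim_null_comparison[OF _ lim]) (simp add: abs_h_le)
    then show ?thesis using True abs_h_le[of q] by (simp add: continuous_within)
  qed
qed

lemma continuous_center:
  assumes q: "q \<in> M" "rad q > 0"
  shows "continuous (at q within M) center"
proof -
  have "open {x. rad x > 0}" using open_Collect_less[of "\<lambda>_. 0" rad] continuous_rad by auto
  then obtain d where d: "d > 0" "ball q d \<subseteq> {x. rad x > 0}"
    using q(2) unfolding open_contains_ball by blast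
  have rc: "continuous (at q within M) rad" 
    using continuous_rad q by (metis continuous_on_eq_continuous_within)
  have "continuous (at q within M) (\<lambda>p. p$3 + R\<^sup>2 * (h p / rad p))"
    using q by (intro continuous_intros continuous_m_h(2)[OF q(1) off_axis[OF q(2)]] rc) auto
  then show ?thesis
    by (rule continuous_transform_within[OF _ d(1) q(1)]) (use d(2) in \<open>force simp: center_def dist_commute subset_iff\<close>)
qed

abbreviation \<phi> where "\<phi> \<equiv> height_test R ((\<lambda>q. q$3) ` char_points)"

lemma isCont_\<phi>: "isCont \<phi> \<tau>"
  using height_test_DERIV[OF finite_imageI[OF finite_char_points]] DERIV_isCont by blast

text \<open>Towards the axis \<open>center\<close> may switch between values near t + R^2 and values
  near t - R^2, but \<open>\<phi>\<close> agrees at these two heights by periodicity.\<close>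

lemma continuous_\<phi>_center: "continuous_on M (\<lambda>p. \<phi> (center p))"
proof (unfold continuous_on_eq_continuous_within, rule ballI)
  fix q assume q: "q \<in> M"
  show "continuous (at q within M) (\<lambda>p. \<phi> (center p))"
  proof (cases "rad q = 0")
    case False
    then have "continuous (at q within M) center" using continuous_center[OF q] rad_nonneg[of q] by simp
    then show ?thesis by (rule continuous_within_compose3[OF isCont_\<phi>])
  next
    case True
    define k where "k x = \<bar>\<phi> (x$3 + half_height x) - \<phi> (q$3 + half_height q)\<bar> + \<bar>\<phi> (x$3 - half_height x) - \<phi> (q$3 - half_height q)\<bar>" for x
    have dc: "continuous (at q within M) half_height"
      using continuous_half_height q by (metis continuous_on_eq_continuous_within)
    have "continuous (at q within M) k"
      unfolding k_def[abs_def]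
      by (intro continuous_intros continuous_within_compose3[OF isCont_\<phi>] dc)
    then have klim: "(k \<longlongrightarrow> 0) (at q within M)" by (simp add: continuous_within k_def)
    have le: "norm (\<phi> (center x) - \<phi> (center q)) \<le> k x" if x: "x \<in> M" for x
    proof -
      have "\<phi> (center q) = \<phi> (q$3 + half_height q)" "\<phi> (center q) = \<phi> (q$3 - half_height q)"
        using True height_test_periodic[OF R_pos] by (simp_all add: center_def half_height_axis)
      then show ?thesis using center_cases[OF x] by (auto simp: k_def)
    qed
    have "((\<lambda>x. \<phi> (center x) - \<phi> (center q)) \<longlongrightarrow> 0) (at q within M)"
      by (rule Lim_null_comparison[OF _ klim]) (use le in \<open>auto simp: eventually_at_filter\<close>)
    then show ?thesis unfolding continuous_within by (rule Lim_null[THEN iffD2])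
  qed
qed

text \<open>The left side is the derivative of t + R h / 2 along a leaf. From c R^2 = 3 and r \<le>
  R the negative part is at most 3 m / 2, which leaves at least m / 2 + R / 2.\<close>

lemma leaf_height_derivative_pos:
  assumes "p \<in> M"
  shows "2 * m p + R / 2 * (1 - c * rad p * m p) > 0"
proof -
  have r: "0 \<le> rad p" "rad p \<le> R" using rad_nonneg rad_le_R[OF assms] by auto
  have m: "m p = rad p ^ 3 / R\<^sup>2" using m_R[OF assms] .
  have m0: "0 \<le> m p" using r by (simp add: m)
  have "R / 2 * (c * rad p * m p) = (c * R\<^sup>2) * (rad p * m p) / (2 * R)"
    using R_pos by (simp add: power2_eq_square)
  also have "\<dots> = 3 / 2 * (rad p / R) * m p" unfolding c_R by simp
  also have "\<dots> \<le> 3 / 2 * 1 * m p"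
    using r R_pos m0 by (intro mult_right_mono mult_left_mono) auto
  finally have "R / 2 * (c * rad p * m p) \<le> 3 / 2 * m p" by simp
  then show ?thesis using m0 R_pos by (simp add: right_diff_distrib)
qed

text \<open>The maximum argument for \<open>\<phi> (center q)\<close> weighted by
  \<open>exp (S q)\<close>. At a characteristic maximum the test function vanishes by construction;
  elsewhere the center is stationary along the leaf while \<open>S\<close> increases
  strictly.\<close>

lemma \<phi>_center_zero:
  assumes "p \<in> M"
  shows "\<phi> (center p) = 0"
proof -
  define S where "S q = q$3 + R / 2 * h q" for q
  define \<Psi> where "\<Psi> q = \<phi> (center q) * exp (S q)" for q
  have "continuous_on M \<Psi>" unfolding \<Psi>_def[abs_def] S_def
    by (intro continuous_intros continuous_\<phi>_center continuous_on_h)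
  then obtain z where z: "z \<in> M" "\<And>y. y \<in> M \<Longrightarrow> \<Psi> y \<le> \<Psi> z"
    using continuous_attains_sup[OF compact nonempty] by blast
  have "\<phi> (center z) = 0"
  proof (cases "characteristic M z")
    case True
    then have "center z = z$3 + R\<^sup>2" using char_axis by (simp add: center_def)
    then show ?thesis using True R_pos finite_char_points
      by (simp add: height_test_pole char_points_def)
  next
    case nc: False
    obtain \<gamma> where \<gamma>: "\<gamma> (0::real) = z" "\<And>s. \<gamma> s \<in> M"
      "((\<lambda>s. \<gamma> s $ 3) has_real_derivative 2 * m z) (at 0)"
      "((\<lambda>s. m (\<gamma> s)) has_real_derivative c * rad z * h z) (at 0)"
      "((\<lambda>s. h (\<gamma> s)) has_real_derivative 1 - c * rad z * m z) (at 0)"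
      "((\<lambda>s. (rad (\<gamma> s))\<^sup>2) has_real_derivative 2 * h z) (at 0)"
      "rad z > 0 \<Longrightarrow> ((\<lambda>s. rad (\<gamma> s)) has_real_derivative h z / rad z) (at 0)"
      by (rule leaf[OF z(1) nc]) (rule that)
    define d where "d = 2 * m z + R / 2 * (1 - c * rad z * m z)"
    have d: "d > 0" unfolding d_def by (rule leaf_height_derivative_pos[OF z(1)])
    have dS: "((\<lambda>s. S (\<gamma> s)) has_real_derivative d) (at 0)"
      unfolding S_def d_def by (intro DERIV_add \<gamma>(3) DERIV_cmult \<gamma>(5))
    \<comment> \<open>It suffices to follow \<open>center\<close> to the right of 0 by some function
      \<open>E\<close> with vanishing derivative; off the axis and on it, different formulas serve
      as \<open>E\<close>.\<close>
    have concl: "\<phi> (center z) = 0"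
      if E: "(E has_real_derivative 0) (at 0)" "\<forall>\<^sub>F s in at_right 0. center (\<gamma> s) = E s" "center z = E 0" for E :: "real \<Rightarrow> real"
    proof -
      obtain d' where "(\<phi> has_real_derivative d') (at (E 0))"
        using height_test_DERIV[OF finite_imageI[OF finite_char_points]] by blast
      from DERIV_chain2[OF this E(1)] have "((\<lambda>s. \<phi> (E s)) has_real_derivative 0) (at 0)" by simp
      moreover have "((\<lambda>s. exp (S (\<gamma> s))) has_real_derivative exp (S z) * d) (at 0)"
        using DERIV_chain2[OF DERIV_exp dS] by (simp add: \<gamma>(1))
      ultimately have "((\<lambda>s. \<phi> (E s) * exp (S (\<gamma> s))) has_real_derivative
          0 * exp (S (\<gamma> 0)) + exp (S z) * d * \<phi> (E 0)) (at 0)"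
        by (rule DERIV_mult)
      moreover have "\<forall>\<^sub>F s in at_right 0. \<phi> (E s) * exp (S (\<gamma> s)) \<le> \<phi> (E 0) * exp (S (\<gamma> 0))"
        using E(2)
      proof eventually_elim
        case (elim s)
        then show ?case using z(2)[OF \<gamma>(2)[of s]] \<gamma>(1) E(3) by (simp add: \<Psi>_def)
      qed
      ultimately have "0 * exp (S (\<gamma> 0)) + exp (S z) * d * \<phi> (E 0) \<le> 0"
        by (rule right_max_derivative)
      then have "\<phi> (E 0) \<le> 0" using d by (simp add: mult_le_0_iff)
      then show ?thesis using height_test_nonneg E(3) by (metis order_antisym)
    qed
    show ?thesis
    proof (cases "rad z = 0")
      case False
      then have r: "rad z > 0" using rad_nonneg[of z] by simp
      note dr = \<gamma>(7)[OF r]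
      have h2: "h z * h z = (rad z)\<^sup>2 - (m z)\<^sup>2"
        using m_h_squares_eq[OF z(1) nc] by (simp add: power2_eq_square)
      have "((\<lambda>s. h (\<gamma> s) / rad (\<gamma> s)) has_real_derivative
          ((1 - c * rad z * m z) * rad z - h z * (h z / rad z)) / (rad z * rad z)) (at 0)"
        using DERIV_divide[OF \<gamma>(5) dr] r by (simp add: \<gamma>(1))
      then have "((\<lambda>s. \<gamma> s $ 3 + R\<^sup>2 * (h (\<gamma> s) / rad (\<gamma> s))) has_real_derivative
          2 * m z + R\<^sup>2 * (((1 - c * rad z * m z) * rad z - h z * (h z / rad z)) / (rad z * rad z))) (at 0)"
        by (intro DERIV_add \<gamma>(3) DERIV_cmult)
      \<comment> \<open>The contributions cancel by c R^2 = 3 and m R^2 = r^3: they are 2 m, R^2 m^2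
        / r^3 = m and -c R^2 m = -3 m.\<close>
      moreover have "2 * m z + R\<^sup>2 * (((1 - c * rad z * m z) * rad z - h z * (h z / rad z)) / (rad z * rad z)) = 0"
      proof -
        have "((1 - c * rad z * m z) * rad z - h z * (h z / rad z)) / (rad z * rad z)
            = ((1 - c * rad z * m z) * rad z - (h z * h z) / rad z) / (rad z * rad z)" by simp
        also have "\<dots> = (m z)\<^sup>2 / rad z ^ 3 - c * m z"
          unfolding h2 using r by (simp add: field_simps power2_eq_square power3_eq_cube)
        finally have "R\<^sup>2 * (((1 - c * rad z * m z) * rad z - h z * (h z / rad z)) / (rad z * rad z))
            = R\<^sup>2 * ((m z)\<^sup>2 / rad z ^ 3) - (c * R\<^sup>2) * m z"
          by (simp add: right_diff_distrib)
        also have "R\<^sup>2 * ((m z)\<^sup>2 / rad z ^ 3) = m z"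
          using r R_pos m_R[OF z(1)] by (simp add: power2_eq_square flip: power_add)
             (simp add: field_simps flip: power_add)
        finally show ?thesis by (simp add: c_R)
      qed
      ultimately have E: "((\<lambda>s. \<gamma> s $ 3 + R\<^sup>2 * (h (\<gamma> s) / rad (\<gamma> s))) has_real_derivative 0) (at 0)" by simp
      have "isCont (\<lambda>s. rad (\<gamma> s)) 0" using dr by (rule DERIV_isCont)
      then have "\<forall>\<^sub>F s in at 0. rad (\<gamma> s) > 0"
        using r \<gamma>(1) unfolding isCont_def by (intro order_tendstoD(1)) auto
      then have "\<forall>\<^sub>F s in at_right 0. rad (\<gamma> s) > 0" by (simp add: eventually_at_split)
      then have "\<forall>\<^sub>F s in at_right 0. center (\<gamma> s) = \<gamma> s $ 3 + R\<^sup>2 * (h (\<gamma> s) / rad (\<gamma> s))"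
        by eventually_elim (simp add: center_def)
      then show ?thesis by (rule concl[OF E]) (use r \<gamma>(1) in \<open>simp add: center_def\<close>)
    next
      case True
      \<comment> \<open>On the axis t' = 2 m = 0 and h' = 1, so the leaf enters the region h > 0,
        where the center is t plus \<open>half_height\<close>.\<close>
      have h0: "h z = 0" "m z = 0" using True abs_h_le[of z] abs_m_le[of z] by simp_all
      have "((\<lambda>s. half_height (\<gamma> s)) has_real_derivative 0) (at 0)"
        by (rule half_height_DERIV_axis) (use \<gamma>(1,6) True h0 in auto)
      from DERIV_add[OF \<gamma>(3) this] have E: "((\<lambda>s. \<gamma> s $ 3 + half_height (\<gamma> s)) has_real_derivative 0) (at 0)"
        by (simp add: h0)
      have "((\<lambda>s. h (\<gamma> s)) has_real_derivative 1) (at 0)" using \<gamma>(5) h0 by simp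
      then obtain \<delta> where \<delta>: "\<delta> > 0" "\<And>s. 0 < s \<Longrightarrow> s < \<delta> \<Longrightarrow> h (\<gamma> s) > 0"
        using has_real_derivative_pos_inc_right[of "\<lambda>s. h (\<gamma> s)" 1 0 UNIV] \<gamma>(1) h0 by force
      then have "\<forall>\<^sub>F s in at_right 0. h (\<gamma> s) > 0" by (auto simp: eventually_at_right intro!: exI[of _ \<delta>])
      then have "\<forall>\<^sub>F s in at_right 0. center (\<gamma> s) = \<gamma> s $ 3 + half_height (\<gamma> s)"
        by eventually_elim (use center_positive_side[OF \<gamma>(2)] in blast)
      then show ?thesis by (rule concl[OF E]) (use True \<gamma>(1) in \<open>simp add: center_def half_height_axis\<close>)
    qed
  qed
  then have "\<Psi> p \<le> 0" using z(2)[OF assms] by (simp add: \<Psi>_def)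
  then have "\<phi> (center p) \<le> 0" by (simp add: \<Psi>_def mult_le_0_iff)
  then show ?thesis using height_test_nonneg by (metis order_antisym)
qed

end

section \<open>Gauge spheres\<close>

text \<open>A frontier point missing from \<open>M\<close> would open a passage between
  \<open>B\<close> and the exterior of its closure; then all of the complement of \<open>M\<close>
  would be outside.\<close>

lemma convex_body_frontier_eq:
  fixes M B :: "'a::euclidean_space set"
  assumes B: "open B" "convex B" and M: "closed M" "M \<subseteq> frontier B" and ins: "inside M \<noteq> {}"
  shows "M = frontier B"
proof (rule ccontr)
  assume "M \<noteq> frontier B"
  then obtain x where x: "x \<in> frontier B" "x \<notin> M" using M(2) by blast
  have fr: "frontier B = closure B - B" using B(1) by (simp add: frontier_def interior_open)
  have far: "- closure B \<subseteq> outside M"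
    by (rule outside_subset_convex) (use B M(2) fr in \<open>auto intro: convex_closure\<close>)
  have fr_out: "y \<in> outside M" if y: "y \<in> frontier B" "y \<notin> M" for y
  proof -
    \<comment> \<open>By convexity \<open>B\<close> is the interior of its closure, so
      \<open>y\<close> is a limit of exterior points; a small ball around \<open>y\<close> avoids
      \<open>M\<close> and links them to \<open>y\<close>.\<close>
    have "interior (closure B) = B" using convex_interior_closure[OF B(2)] B(1) by (simp add: interior_open)
    then have "y \<in> closure (- closure B)" using y(1) unfolding closure_complement fr by simp
    moreover obtain r where r: "r > 0" "ball y r \<subseteq> - M"
      using M(1) y(2) open_contains_ball[of "- M"] by auto
    ultimately obtain w where w: "w \<in> - closure B" "dist w y < r"
      by (metis closure_approachable)
    have "connected_component (- M) w y"
      unfolding connected_component_def using r w(2)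
      by (intro exI[of _ "ball y r"]) (auto simp: dist_commute)
    then show ?thesis using far w(1) outside_same_component by blast
  qed
  have "connected (insert x B)"
    by (rule connected_intermediate_closure[OF convex_connected[OF B(2)]])
      (use x(1) fr in \<open>auto intro: closure_subset[THEN subsetD]\<close>)
  moreover have "insert x B \<subseteq> - M" using x(2) M(2) fr by auto
  ultimately have "connected_component (- M) x y" if "y \<in> B" for y
    unfolding connected_component_def using that by (intro exI[of _ "insert x B"]) auto
  then have "B \<subseteq> outside M" using fr_out[OF x] outside_same_component by blast
  then have "- M \<subseteq> outside M" using far fr_out fr by blast
  then have "inside M \<subseteq> outside M" using inside_Un_outside[of M] by blast
  then show False using ins inside_Int_outside[of M] by blast
qed

lemma rad_eq_norm: "rad p = norm (p$1, p$2)"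
  by (simp add: rad_def norm_Pair)

lemma rad_convex:
  assumes "0 \<le> u" "0 \<le> v"
  shows "rad (u *\<^sub>R p + v *\<^sub>R q) \<le> u * rad p + v * rad q"
proof -
  have "rad (u *\<^sub>R p + v *\<^sub>R q) = norm (u *\<^sub>R (p$1, p$2) + v *\<^sub>R (q$1, q$2))"
    by (simp add: rad_eq_norm)
  also have "\<dots> \<le> norm (u *\<^sub>R (p$1, p$2)) + norm (v *\<^sub>R (q$1, q$2))" by (rule norm_triangle_ineq)
  also have "\<dots> = u * rad p + v * rad q"
    unfolding rad_eq_norm using assms by (simp only: norm_scaleR abs_of_nonneg)
  finally show ?thesis .
qed

text \<open>The twisting term of the group law vanishes for a base point on the axis, so the left
  translation is a Euclidean vertical shift.\<close>

lemma gauge_ball_axis: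
  assumes "R > 0"
  shows "gauge_ball (vector [0, 0, t0]) R = {p. rad p ^ 4 + (p$3 - t0)\<^sup>2 < R ^ 4}"
proof -
  have "homogeneous_gauge (heis_mult (heis_inv (vector [0, 0, t0])) p) = root 4 (rad p ^ 4 + (p$3 - t0)\<^sup>2)" for p
  proof -
    have "((p$1)\<^sup>2 + (p$2)\<^sup>2)\<^sup>2 = rad p ^ 4" unfolding rad_sq[symmetric] by (simp flip: power_mult)
    then show ?thesis by (simp add: homogeneous_gauge_def heis_mult_def heis_inv_def vector_3)
  qed
  moreover have "root 4 x < R \<longleftrightarrow> x < R ^ 4" for x
  proof -
    have "root 4 (R ^ 4) = R" using assms by (simp add: real_root_power_cancel)
    then show ?thesis by (metis real_root_less_iff zero_less_numeral)
  qed
  ultimately show ?thesis by (simp add: gauge_ball_def)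
qed

lemma continuous_gauge: "continuous_on S (\<lambda>p::real^3. rad p ^ 4 + (p$3 - t0)\<^sup>2)"
  by (intro continuous_intros continuous_rad)

lemma open_gauge_ball_axis:
  assumes "R > 0"
  shows "open (gauge_ball (vector [0, 0, t0]) R)"
  unfolding gauge_ball_axis[OF assms]
  by (intro open_Collect_less continuous_gauge continuous_on_const)

text \<open>The ball is the preimage of a round disc under (r^2, t - t0). As r^2 is convex and
  nonnegative, replacing the convex combination of its values by its value at the combined point
  only shortens the vector.\<close>

lemma convex_gauge_ball_axis:
  assumes "R > 0"
  shows "convex (gauge_ball (vector [0, 0, t0]) R)"
proof (rule convexI)
  fix p q and u v :: real
  assume p: "p \<in> gauge_ball (vector [0, 0, t0]) R" and q: "q \<in> gauge_ball (vector [0, 0, t0]) R"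
    and uv: "0 \<le> u" "0 \<le> v" "u + v = 1"
  have ball: "x \<in> gauge_ball (vector [0, 0, t0]) R \<longleftrightarrow> ((rad x)\<^sup>2, x$3 - t0) \<in> ball 0 (R\<^sup>2)" for x
  proof -
    have "norm ((rad x)\<^sup>2, x$3 - t0) < R\<^sup>2 \<longleftrightarrow> (norm ((rad x)\<^sup>2, x$3 - t0))\<^sup>2 < (R\<^sup>2)\<^sup>2"
      using power_strict_mono[of "norm ((rad x)\<^sup>2, x$3 - t0)" "R\<^sup>2" 2]
        power_less_imp_less_base[of "norm ((rad x)\<^sup>2, x$3 - t0)" 2 "R\<^sup>2"] by auto
    then show ?thesis unfolding gauge_ball_axis[OF assms]
      by (simp add: norm_Pair flip: power_mult)
  qed
  let ?w = "u *\<^sub>R p + v *\<^sub>R q"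
  have sum: "u *\<^sub>R ((rad p)\<^sup>2, p$3 - t0) + v *\<^sub>R ((rad q)\<^sup>2, q$3 - t0)
      = (u * (rad p)\<^sup>2 + v * (rad q)\<^sup>2, ?w$3 - t0)"
  proof -
    have "t0 = u * t0 + v * t0" using uv(3) by (simp flip: distrib_right)
    then show ?thesis by (simp add: algebra_simps)
  qed
  have in_ball: "u *\<^sub>R ((rad p)\<^sup>2, p$3 - t0) + v *\<^sub>R ((rad q)\<^sup>2, q$3 - t0) \<in> ball 0 (R\<^sup>2)"
    using convex_ball[of "0 :: real \<times> real" "R\<^sup>2"] p q uv unfolding ball by (rule convexD)
  have "(rad ?w)\<^sup>2 \<le> (u * rad p + v * rad q)\<^sup>2"
    using rad_convex[OF uv(1,2)] rad_nonneg by (intro power_mono) auto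
  also have "\<dots> = u * (rad p)\<^sup>2 + v * (rad q)\<^sup>2 - u * v * (rad p - rad q)\<^sup>2"
  proof -
    have v: "v = 1 - u" using uv(3) by simp
    show ?thesis unfolding v by (simp add: power2_eq_square algebra_simps)
  qed
  also have "\<dots> \<le> u * (rad p)\<^sup>2 + v * (rad q)\<^sup>2" using uv by simp
  finally have "((rad ?w)\<^sup>2)\<^sup>2 \<le> (u * (rad p)\<^sup>2 + v * (rad q)\<^sup>2)\<^sup>2" by (intro power_mono) auto
  then have "norm ((rad ?w)\<^sup>2, ?w$3 - t0) \<le> norm (u * (rad p)\<^sup>2 + v * (rad q)\<^sup>2, ?w$3 - t0)"
    unfolding norm_Pair by (simp only: real_sqrt_le_iff real_norm_def power2_abs add_right_mono)
  also have "\<dots> < R\<^sup>2" using in_ball unfolding sum by simp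
  finally show "?w \<in> gauge_ball (vector [0, 0, t0]) R" unfolding ball by simp
qed

lemma frontier_gauge_ball_axis:
  assumes "R > 0"
  shows "frontier (gauge_ball (vector [0, 0, t0]) R) = {p. rad p ^ 4 + (p$3 - t0)\<^sup>2 = R ^ 4}"
proof -
  let ?K = "\<lambda>p::real^3. rad p ^ 4 + (p$3 - t0)\<^sup>2"
  have "closure (gauge_ball (vector [0, 0, t0]) R) = {p. ?K p \<le> R ^ 4}"
  proof
    show "closure (gauge_ball (vector [0, 0, t0]) R) \<subseteq> {p. ?K p \<le> R ^ 4}"
      unfolding gauge_ball_axis[OF assms]
      by (intro closure_minimal closed_Collect_le continuous_gauge continuous_on_const) auto
    show "{p. ?K p \<le> R ^ 4} \<subseteq> closure (gauge_ball (vector [0, 0, t0]) R)"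
    proof
      fix p assume p: "p \<in> {p. ?K p \<le> R ^ 4}"
      \<comment> \<open>Shrinking towards the center by a factor s < 1 turns r^4 + (t - t0)^2 into
        s^4 r^4 + s^2 (t - t0)^2, at most s^2 R^4, so \<open>p\<close> is a limit of points of the
        open ball.\<close>
      define z :: "real^3" where "z = vector [0, 0, t0]"
      define s where "s n = 1 - inverse (real (Suc n))" for n
      define x where "x n = z + s n *\<^sub>R (p - z)" for n
      have "s \<longlonglongrightarrow> 1 - 0" unfolding s_def by (intro tendsto_intros LIMSEQ_inverse_real_of_nat)
      then have "x \<longlonglongrightarrow> z + (1 - 0) *\<^sub>R (p - z)" unfolding x_def by (intro tendsto_intros)
      then have "x \<longlonglongrightarrow> p" by simp
      moreover have "x n \<in> gauge_ball (vector [0, 0, t0]) R" for n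
      proof -
        have s: "0 \<le> s n" "s n < 1" by (auto simp: s_def field_simps)
        have "(rad (x n))\<^sup>2 = (s n)\<^sup>2 * (rad p)\<^sup>2"
          unfolding rad_sq by (simp add: x_def z_def vector_3 power_mult_distrib algebra_simps)
        then have "((rad (x n))\<^sup>2)\<^sup>2 = ((s n)\<^sup>2)\<^sup>2 * ((rad p)\<^sup>2)\<^sup>2" by (simp add: power_mult_distrib)
        then have "rad (x n) ^ 4 = (s n) ^ 4 * rad p ^ 4" by (simp flip: power_mult)
        moreover have "x n $ 3 - t0 = s n * (p$3 - t0)" by (simp add: x_def z_def vector_3 algebra_simps)
        ultimately have "?K (x n) = (s n) ^ 4 * rad p ^ 4 + (s n)\<^sup>2 * (p$3 - t0)\<^sup>2"
          by (simp add: power_mult_distrib)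
        also have "\<dots> = (s n)\<^sup>2 * ((s n)\<^sup>2 * rad p ^ 4 + (p$3 - t0)\<^sup>2)"
          by (simp add: distrib_left flip: power_add mult.assoc)
        also have "\<dots> \<le> (s n)\<^sup>2 * (1 * rad p ^ 4 + (p$3 - t0)\<^sup>2)"
          using s by (intro mult_left_mono add_right_mono mult_right_mono power_le_one) auto
        also have "\<dots> \<le> (s n)\<^sup>2 * R ^ 4" using p by (intro mult_left_mono) auto
        also have "\<dots> < 1 * R ^ 4"
          using s assms by (intro mult_strict_right_mono) (auto simp: abs_square_less_1)
        finally show ?thesis unfolding gauge_ball_axis[OF assms] by simp
      qed
      ultimately show "p \<in> closure (gauge_ball (vector [0, 0, t0]) R)"
        by (auto simp: closure_sequential)
    qed
  qed
  moreover have "{p. k p \<le> r} - {p. k p < r} = {p. k p = r}" for k :: "real^3 \<Rightarrow> real" and r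
    by auto
  ultimately show ?thesis
    unfolding frontier_def interior_open[OF open_gauge_ball_axis[OF assms]]
    by (simp only: gauge_ball_axis[OF assms])
qed

section \<open>Confinement to one gauge sphere\<close>

context surface_with_curvature
begin

lemma finite_range_center: "finite (center ` M)"
proof -
  obtain K where K: "\<And>x. x \<in> M \<Longrightarrow> norm x \<le> K" using compact_imp_bounded[OF compact] by (auto simp: bounded_iff)
  have z: "\<bar>x$3\<bar> \<le> K" if "x \<in> M" for x using K[OF that] component_le_norm_cart[of x 3] by linarith
  \<comment> \<open>From i R^2 = center p - t with |center p| \<le> K + R^2 and |t| \<le> K.\<close>
  define N where "N = \<lceil>(2 * K + R\<^sup>2) / R\<^sup>2\<rceil>"
  have "center ` M \<subseteq> (\<lambda>(t, i). t + of_int i * R\<^sup>2) ` (((\<lambda>q. q$3) ` char_points) \<times> {- N..N})"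
  proof
    fix \<tau> assume "\<tau> \<in> center ` M"
    then obtain p where p: "p \<in> M" "\<tau> = center p" by blast
    obtain t i where ti: "t \<in> (\<lambda>q. q$3) ` char_points" "center p = t + of_int i * R\<^sup>2"
      by (rule height_test_zeroD[OF R_pos finite_imageI[OF finite_char_points] \<phi>_center_zero[OF p(1)]]) (rule that)
    have "\<bar>t\<bar> \<le> K" using ti(1) z by (auto simp: char_points_def characteristic_def)
    moreover have "0 \<le> half_height p \<and> half_height p \<le> R\<^sup>2"
    proof -
      have "half_height p \<le> R\<^sup>2" unfolding half_height_def by (rule real_le_lsqrt) (simp_all flip: power_mult)
      moreover have "rad p ^ 4 \<le> R ^ 4" using rad_le_R[OF p(1)] rad_nonneg by (intro power_mono) auto
      ultimately show ?thesis by (simp add: half_height_def)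
    qed
    ultimately have "\<bar>real_of_int i * R\<^sup>2\<bar> \<le> 2 * K + R\<^sup>2"
      using center_cases[OF p(1)] z[OF p(1)] ti(2) by (auto simp: abs_le_iff)
    then have "\<bar>real_of_int i\<bar> \<le> (2 * K + R\<^sup>2) / R\<^sup>2" using R_pos by (simp add: field_simps abs_mult)
    then have "\<bar>i\<bar> \<le> N" unfolding N_def by linarith
    then have "i \<in> {- N..N}" by auto
    then show "\<tau> \<in> (\<lambda>(t, i). t + of_int i * R\<^sup>2) ` (((\<lambda>q. q$3) ` char_points) \<times> {- N..N})"
      using p(2) ti by (auto intro!: image_eqI[of _ _ "(t, i)"])
  qed
  then show ?thesis
    by (rule finite_subset) (intro finite_imageI finite_SigmaI finite_char_points finite_atLeastAtMost_int)
qed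

text \<open>Otherwise some tangent vector has a vertical component. Along a curve in that direction
  \<open>half_height\<close> is stationary, and since \<open>center\<close> has finitely many
  values, t changes only by the change of \<open>half_height\<close> up to sign; so t is stationary
  as well.\<close>

lemma axis_point_characteristic:
  assumes p: "p \<in> M" "rad p = 0"
  shows "characteristic M p"
proof (rule ccontr)
  assume nc: "\<not> characteristic M p"
  obtain g where g: "g \<noteq> 0" "tangent_space M p = {v. g \<bullet> v = 0}" "\<nu> p = heis_normal g p"
    by (rule surface_gradient[OF p(1)]) (rule that)
  have xy: "p$1 = 0" "p$2 = 0" using p(2) by (simp_all add: rad_eq_0_iff)
  have "g$1 \<noteq> 0 \<or> g$2 \<noteq> 0"
    using nc characteristic_iff[OF p(1) g(2,1)] xy by (simp add: inner_heis_frame)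
  moreover have "vector [g$3, 0, - g$1] \<in> tangent_space M p" "vector [0, g$3, - g$2] \<in> tangent_space M p"
    by (simp_all add: g(2) inner_real3 vector_3)
  ultimately obtain v where v: "v \<in> tangent_space M p" "v$3 \<noteq> 0"
    by (metis neg_equal_0_iff_equal vector_3(3))
  obtain \<gamma> where \<gamma>: "\<gamma> (0::real) = p" "\<And>s. \<gamma> s \<in> M" "\<And>i. ((\<lambda>s. \<gamma> s $ i) has_real_derivative v $ i) (at 0)"
    by (rule tangent_curve[OF v(1) p(1)]) (rule that)
  have "((\<lambda>s. (rad (\<gamma> s))\<^sup>2) has_real_derivative 0) (at 0)"
    unfolding rad_sq by (auto intro!: derivative_eq_intros \<gamma>(3) simp: \<gamma>(1) xy)
  then have dd: "((\<lambda>s. half_height (\<gamma> s)) has_real_derivative 0) (at 0)"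
    by (rule half_height_DERIV_axis) (simp add: \<gamma>(1) p(2))
  \<comment> \<open>Nearby values of a continuous function that lie in a finite set must equal the
    value at 0.\<close>
  have near: "\<forall>\<^sub>F s in at 0. E s \<in> center ` M \<longrightarrow> E s = E 0" if "isCont E 0" for E :: "real \<Rightarrow> real"
  proof -
    obtain d where d: "d > 0" "\<forall>x\<in>center ` M. x \<noteq> E 0 \<longrightarrow> d \<le> dist (E 0) x"
      using finite_set_avoid[OF finite_range_center, of "E 0"] by blast
    have "\<forall>\<^sub>F s in at 0. dist (E s) (E 0) < d"
      using that d(1) unfolding isCont_def by (rule tendstoD)
    then show ?thesis by eventually_elim (use d(2) in \<open>force simp: dist_commute\<close>)
  qed
  have cont: "isCont (\<lambda>s. \<gamma> s $ 3) 0" "isCont (\<lambda>s. half_height (\<gamma> s)) 0"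
    using DERIV_isCont[OF \<gamma>(3)] DERIV_isCont[OF dd] by auto
  have "\<forall>\<^sub>F s in at 0. \<gamma> s $ 3 + half_height (\<gamma> s) \<in> center ` M \<longrightarrow> \<gamma> s $ 3 + half_height (\<gamma> s) = p$3 + R\<^sup>2"
    using near[OF isCont_add[OF cont]] by (simp add: \<gamma>(1) half_height_axis p(2))
  moreover have "\<forall>\<^sub>F s in at 0. \<gamma> s $ 3 - half_height (\<gamma> s) \<in> center ` M \<longrightarrow> \<gamma> s $ 3 - half_height (\<gamma> s) = p$3 - R\<^sup>2"
    using near[OF isCont_diff[OF cont]] by (simp add: \<gamma>(1) half_height_axis p(2))
  \<comment> \<open>The sign may vary with \<open>s\<close>, so the difference quotients are
    compared after squaring.\<close>
  ultimately have ev: "\<forall>\<^sub>F s in at 0. ((half_height (\<gamma> s) - half_height (\<gamma> 0)) / s)\<^sup>2 = ((\<gamma> s $ 3 - \<gamma> 0 $ 3) / s)\<^sup>2"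
  proof eventually_elim
    case (elim s)
    have "center (\<gamma> s) \<in> center ` M" using \<gamma>(2) by blast
    then have "\<gamma> s $ 3 - p$3 = - (half_height (\<gamma> s) - R\<^sup>2) \<or> \<gamma> s $ 3 - p$3 = half_height (\<gamma> s) - R\<^sup>2"
      using center_cases[OF \<gamma>(2)[of s]] elim by auto
    then have "(\<gamma> s $ 3 - p$3)\<^sup>2 = (half_height (\<gamma> s) - R\<^sup>2)\<^sup>2" by (metis power2_minus)
    then show ?case by (simp add: power_divide \<gamma>(1) half_height_axis p(2))
  qed
  have "((\<lambda>s. ((half_height (\<gamma> s) - half_height (\<gamma> 0)) / s)\<^sup>2) \<longlongrightarrow> 0\<^sup>2) (at 0)"
    using dd unfolding has_field_derivative_iff by (intro tendsto_power) simp
  then have "((\<lambda>s. ((\<gamma> s $ 3 - \<gamma> 0 $ 3) / s)\<^sup>2) \<longlongrightarrow> 0\<^sup>2) (at 0)"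
    by (rule Lim_transform_eventually[OF _ ev])
  moreover have "((\<lambda>s. ((\<gamma> s $ 3 - \<gamma> 0 $ 3) / s)\<^sup>2) \<longlongrightarrow> (v$3)\<^sup>2) (at 0)"
    using \<gamma>(3)[of 3] unfolding has_field_derivative_iff by (intro tendsto_power) simp
  ultimately have "0\<^sup>2 = (v$3)\<^sup>2" by (rule tendsto_unique[OF at_neq_bot])
  then show False using v(2) by simp
qed

text \<open>The point \<open>p\<close> itself is left out because on the axis \<open>center\<close>
  is fixed by convention and may be the wrong one of the two candidates.\<close>

definition center_at where
  "center_at p \<tau> \<longleftrightarrow> (\<exists>U. open U \<and> p \<in> U \<and> (\<forall>x\<in>M \<inter> U - {p}. center x = \<tau>))"

lemma surface_islimpt: "p \<in> M \<Longrightarrow> p islimpt M"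
  by (rule surface_local[OF _ open_UNIV UNIV_I])

lemma center_at_unique:
  assumes "p \<in> M" "center_at p \<tau>" "center_at p \<tau>'"
  shows "\<tau> = \<tau>'"
proof -
  obtain U U' where U: "open U" "p \<in> U" "\<forall>x\<in>M \<inter> U - {p}. center x = \<tau>"
      "open U'" "p \<in> U'" "\<forall>x\<in>M \<inter> U' - {p}. center x = \<tau>'"
    using assms(2,3) unfolding center_at_def by blast
  obtain x where "x \<in> M" "x \<in> U \<inter> U'" "x \<noteq> p"
    using surface_islimpt[OF assms(1)] U(1,2,4,5) by (metis IntI islimptE open_Int)
  then have "center x = \<tau>" "center x = \<tau>'" using U(3,6) by auto
  then show ?thesis by simp
qed

text \<open>Other characteristic points are removed from the neighbourhood, so the punctured piece
  of \<open>M\<close> is connected and off the axis; there \<open>center\<close> is continuous with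
  finitely many values.\<close>

lemma center_at_exists:
  assumes p: "p \<in> M"
  shows "\<exists>\<tau>. center_at p \<tau>"
proof -
  let ?W = "- (char_points - {p})"
  have W: "open ?W" "p \<in> ?W"
    by (intro open_Compl finite_imp_closed finite_Diff finite_char_points) simp
  obtain U f G where U: "open U" "p \<in> U" "U \<subseteq> ?W"
    "\<And>x. x \<in> U \<Longrightarrow> (f has_derivative (\<lambda>h. G x \<bullet> h)) (at x)"
    "\<And>x. x \<in> U \<Longrightarrow> G differentiable (at x)" "\<And>x. x \<in> U \<Longrightarrow> G x \<noteq> 0"
    "M \<inter> U = {x \<in> U. f x = 0}" "connected (M \<inter> U - {p})" "p islimpt M"
    "\<And>x. x \<in> M \<inter> U \<Longrightarrow> tangent_space M x = {v. G x \<bullet> v = 0}"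
    "\<And>x. x \<in> M \<inter> U \<Longrightarrow> \<nu> x = heis_normal (G x) x"
    by (rule surface_local[OF p W]) (rule that)
  have off: "rad x > 0" if x: "x \<in> M \<inter> U - {p}" for x
  proof (rule ccontr)
    assume "\<not> rad x > 0"
    then have "rad x = 0" using rad_nonneg[of x] by simp
    then have "x \<in> char_points" using axis_point_characteristic x by (simp add: char_points_def)
    then show False using x U(3) by blast
  qed
  have "continuous (at x within M \<inter> U - {p}) center" if "x \<in> M \<inter> U - {p}" for x
    using continuous_center[of x] off[OF that] that by (auto elim: continuous_within_subset)
  then have "continuous_on (M \<inter> U - {p}) center" by (simp add: continuous_on_eq_continuous_within)
  moreover have "finite (center ` (M \<inter> U - {p}))" by (rule finite_subset[OF _ finite_range_center]) auto
  ultimately have "center constant_on (M \<inter> U - {p})" using U(8) continuous_finite_range_constant by blast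
  then show ?thesis unfolding center_at_def constant_on_def using U(1,2) by blast
qed

text \<open>The local values form a locally constant function on the connected \<open>M\<close>.
  Near \<open>p\<close> every other point of \<open>M\<close> lies on the corresponding sphere, and
  \<open>p\<close> follows as a limit point of this closed set.\<close>

lemma in_gauge_sphere: "\<exists>t0. M \<subseteq> {p. rad p ^ 4 + (p$3 - t0)\<^sup>2 = R ^ 4}"
proof -
  define C where "C p = (SOME \<tau>. center_at p \<tau>)" for p
  have C: "center_at p (C p)" if "p \<in> M" for p
    unfolding C_def using someI_ex[OF center_at_exists[OF that]] .
  have "\<forall>\<^sub>F q in at p within M. C p = C q" if p: "p \<in> M" for p
  proof -
    obtain U where U: "open U" "p \<in> U" "\<forall>x\<in>M \<inter> U - {p}. center x = C p"
      using C[OF p] unfolding center_at_def by blast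
    have "C p = C q" if q: "q \<in> M" "q \<in> U" "q \<noteq> p" for q
    proof (rule center_at_unique[OF q(1) _ C[OF q(1)]])
      show "center_at q (C p)"
        unfolding center_at_def by (rule exI[of _ "U - {p}"]) (use U q in auto)
    qed
    then show ?thesis unfolding eventually_at_topological using U(1,2) by blast
  qed
  then have const: "C p = C q" if "p \<in> M" "q \<in> M" for p q
    using connected_local_const[OF connected that] by blast
  obtain p0 where p0: "p0 \<in> M" using nonempty by blast
  have "rad p ^ 4 + (p$3 - C p0)\<^sup>2 = R ^ 4" if p: "p \<in> M" for p
  proof -
    let ?S = "{p. rad p ^ 4 + (p$3 - C p0)\<^sup>2 = R ^ 4}"
    obtain U where U: "open U" "p \<in> U" "\<forall>x\<in>M \<inter> U - {p}. center x = C p0"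
      using C[OF p] const[OF p p0] unfolding center_at_def by auto
    have "x \<in> ?S" if x: "x \<in> M \<inter> U - {p}" for x
    proof -
      have "rad x ^ 4 \<le> R ^ 4" using x rad_le_R rad_nonneg by (intro power_mono) auto
      then have "(half_height x)\<^sup>2 = R ^ 4 - rad x ^ 4" by (simp add: half_height_def)
      moreover have "x$3 - C p0 = - half_height x \<or> x$3 - C p0 = half_height x"
        using center_cases[of x] U(3) x by force
      then have "(x$3 - C p0)\<^sup>2 = (half_height x)\<^sup>2" by (metis power2_minus)
      ultimately show ?thesis by simp
    qed
    then have sub: "M \<inter> U - {p} \<subseteq> ?S" by blast
    have "p islimpt (M \<inter> U - {p})"
      unfolding islimpt_def
    proof (intro allI impI)
      fix T assume "p \<in> T" "open T"
      then obtain y where "y \<in> M" "y \<in> T \<inter> U" "y \<noteq> p"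
        using surface_islimpt[OF p] U(1,2) by (metis IntI islimptE open_Int)
      then show "\<exists>y\<in>M \<inter> U - {p}. y \<in> T \<and> y \<noteq> p" by blast
    qed
    then have "p islimpt ?S" using sub islimpt_subset by blast
    moreover have "closed ?S" by (intro closed_Collect_eq continuous_gauge continuous_on_const)
    ultimately show ?thesis using closed_limpt by blast
  qed
  then show ?thesis by blast
qed

lemma gauge_sphere:
  "c > 0 \<and> (\<exists>t0. M = frontier (gauge_ball (vector [0, 0, t0]) (sqrt (3 / c))))"
proof -
  obtain t0 where t0: "M \<subseteq> {p. rad p ^ 4 + (p$3 - t0)\<^sup>2 = R ^ 4}" using in_gauge_sphere by blast
  obtain p where p: "p \<in> M" using nonempty by blast
  have "\<forall>\<^sub>F s in at_right (0::real). p - s *\<^sub>R \<nu> p \<in> inside M"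
    using outward p unfolding outward_unit_normal_def by (auto elim: eventually_mono)
  \<comment> \<open>The outward normal supplies an inside point, so \<open>M\<close> separates space
    and must fill the whole sphere.\<close>
  then have "inside M \<noteq> {}"
    using eventually_happens'[OF trivial_limit_at_right_real] by blast
  then have "M = frontier (gauge_ball (vector [0, 0, t0]) R)"
    using t0 compact_imp_closed[OF compact] R_pos
    by (intro convex_body_frontier_eq open_gauge_ball_axis convex_gauge_ball_axis)
      (simp_all add: frontier_gauge_ball_axis)
  then show ?thesis using c_pos unfolding R_def by blast
qed

end

theorem theorem1p1:
  fixes M :: "(real^3) set" and \<nu> :: "real^3 \<Rightarrow> real^3" and c :: real
  assumes "smooth_surface M"
    and "M \<noteq> {}" and "connected M" and "compact M"
    and "orientable_surface M"
    and "outward_unit_normal M \<nu>"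
    and "\<And>p. characteristic M p \<Longrightarrow> p \<in> {vector [0, 0, t] | t. True}"
    and "c \<noteq> 0"
    and "\<And>p. p \<in> M \<Longrightarrow> \<not> characteristic M p \<Longrightarrow>
           horizontal_mean_curvature M \<nu> p = c * sqrt ((p$1)\<^sup>2 + (p$2)\<^sup>2)"
  shows "c > 0 \<and> (\<exists>t0::real. M = frontier (gauge_ball (vector [0, 0, t0]) (sqrt (3 / c))))"
proof -
  interpret surface_with_curvature M \<nu> c
  proof
    show "rad p = 0" if "characteristic M p" for p
      using assms(7)[OF that] by (auto simp: rad_def vector_3)
    show "horizontal_mean_curvature M \<nu> p = c * rad p" if "p \<in> M" "\<not> characteristic M p" for p
      using assms(9)[OF that] by (simp add: rad_def)
  qed (use assms in auto)
  show ?thesis by (rule gauge_sphere)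
qed

end
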